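(* Let $G=\mathbb{Z}\times G_0$ for some explicit finite abelian group $G_0$, let $J\geq1$ be a standard integer, let $F_1,\dots,F_J$ be finite subsets of $G$, and let $E$ be a periodic subset of $G$. Then the tiling equation $\operatorname{Tile}(F_1,\dots,F_J;E)$ is not aperiodic (and hence also decidable).
   Context: An explicit finite abelian group is $\mathbb{Z}_{N_1}\times\dots\times\mathbb{Z}_{N_k}$ with standard positive $N_i$. A subset of $G$ is periodic if it is a finite union of cosets of a finite-index subgroup. For subsets $A,F$, $A\oplus F$ is $\{a+f\}$ if all sums $a+f$ are distinct and undefined otherwise; $A\uplus B$ is $A\cup B$ if disjoint and undefined otherwise; equations with undefined terms are false. $\operatorname{Tile}(F_1,\dots,F_J;E)$ is the equation $\biguplus_{j=1}^J X_j\oplus F_j=E$ in unknown sets $X_1,\dots,X_J\subset G$. It is aperiodic if, in the standard universe of ZFC, it has a solution but no solution with all $X_j$ periodic. It is undecidable if the sentence asserting that a solution exists is not provable in ZFC (equivalently, as the paper puts it, solutions exist in some universes of ZFC and not in others), and decidable otherwise. *)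

theory Defs
  imports "HOL-Algebra.Product_Groups" "HOL-Library.Disjoint_Sets"
begin

section \<open>Tiling equations in a group\<close>

text \<open>The group of integers times the product of the cyclic groups of orders \<open>Ns ! 0\<close>,
  \<open>Ns ! 1\<close>, \<dots>; the list may be empty.\<close>

definition Z_times :: "nat list \<Rightarrow> (int \<times> (nat \<Rightarrow> int)) monoid" where
  "Z_times Ns =
     integer_group \<times>\<times> product_group {..<length Ns} (\<lambda>i. integer_mod_group (Ns ! i))"

definition periodic_set :: "('g, 'm) monoid_scheme \<Rightarrow> 'g set \<Rightarrow> bool" where
  "periodic_set G S \<longleftrightarrow>
     (\<exists>H \<C>. subgroup H G \<and> finite (rcosets\<^bsub>G\<^esub> H) \<and>
            \<C> \<subseteq> rcosets\<^bsub>G\<^esub> H \<and> finite \<C> \<and> S = \<Union>\<C>)"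

text \<open>An equation with an undefined term is false, so the conditions under which the direct sums
  and the disjoint union are defined are conjuncts here.\<close>

definition tiling ::
  "('g, 'm) monoid_scheme \<Rightarrow> nat \<Rightarrow> (nat \<Rightarrow> 'g set) \<Rightarrow> 'g set \<Rightarrow> (nat \<Rightarrow> 'g set) \<Rightarrow> bool" where
  "tiling G J F E A \<longleftrightarrow>
     (\<forall>j\<in>{1..J}. A j \<subseteq> carrier G \<and> inj_on (\<lambda>(x, f). x \<otimes>\<^bsub>G\<^esub> f) (A j \<times> F j)) \<and>
     disjoint_family_on (\<lambda>j. A j <#>\<^bsub>G\<^esub> F j) {1..J} \<and>
     (\<Union>j\<in>{1..J}. A j <#>\<^bsub>G\<^esub> F j) = E"

definition aperiodic_tile ::
  "('g, 'm) monoid_scheme \<Rightarrow> nat \<Rightarrow> (nat \<Rightarrow> 'g set) \<Rightarrow> 'g set \<Rightarrow> bool" where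
  "aperiodic_tile G J F E \<longleftrightarrow>
     (\<exists>A. tiling G J F E A) \<and>
     \<not> (\<exists>A. tiling G J F E A \<and> (\<forall>j\<in>{1..J}. periodic_set G (A j)))"


section \<open>Universes of ZFC\<close>

text \<open>First-order formulas in the language of set theory, with variables named by natural numbers.\<close>

datatype fm = Mem nat nat | Eq nat nat | Neg fm | Conj fm fm | Exists nat fm

locale set_structure =
  fixes U :: "'u set" and mem :: "'u \<Rightarrow> 'u \<Rightarrow> bool" (infix \<open>\<E>\<close> 50)
begin

primrec sat :: "fm \<Rightarrow> (nat \<Rightarrow> 'u) \<Rightarrow> bool" where
  "sat (Mem m n) e \<longleftrightarrow> e m \<E> e n"
| "sat (Eq m n) e \<longleftrightarrow> e m = e n"
| "sat (Neg p) e \<longleftrightarrow> \<not> sat p e"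
| "sat (Conj p q) e \<longleftrightarrow> sat p e \<and> sat q e"
| "sat (Exists n p) e \<longleftrightarrow> (\<exists>x\<in>U. sat p (e(n := x)))"

end

text \<open>Models of first-order ZFC. Separation and Replacement are schemas over formulas, whose
  parameters are supplied by the assignment \<open>e\<close>; the models need not be transitive, well-founded
  or \<open>\<omega>\<close>-standard.\<close>

locale zfc_universe = set_structure +
  assumes extensionality:
    "\<lbrakk>x \<in> U; y \<in> U; \<forall>z\<in>U. z \<E> x \<longleftrightarrow> z \<E> y\<rbrakk> \<Longrightarrow> x = y"
  and foundation:
    "\<lbrakk>x \<in> U; \<exists>y\<in>U. y \<E> x\<rbrakk> \<Longrightarrow> \<exists>y\<in>U. y \<E> x \<and> \<not> (\<exists>z\<in>U. z \<E> x \<and> z \<E> y)"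
  and pairing:
    "\<lbrakk>a \<in> U; b \<in> U\<rbrakk> \<Longrightarrow> \<exists>y\<in>U. \<forall>x\<in>U. x \<E> y \<longleftrightarrow> x = a \<or> x = b"
  and union:
    "a \<in> U \<Longrightarrow> \<exists>y\<in>U. \<forall>x\<in>U. x \<E> y \<longleftrightarrow> (\<exists>b\<in>U. b \<E> a \<and> x \<E> b)"
  and power_set:
    "a \<in> U \<Longrightarrow> \<exists>y\<in>U. \<forall>x\<in>U. x \<E> y \<longleftrightarrow> (\<forall>z\<in>U. z \<E> x \<longrightarrow> z \<E> a)"
  and infinity:
    "\<exists>I\<in>U. (\<exists>z\<in>U. z \<E> I \<and> (\<forall>w\<in>U. \<not> w \<E> z)) \<and>
       (\<forall>x\<in>U. x \<E> I \<longrightarrow> (\<exists>y\<in>U. y \<E> I \<and> (\<forall>w\<in>U. w \<E> y \<longleftrightarrow> w \<E> x \<or> w = x)))"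
  and separation:
    "\<lbrakk>range e \<subseteq> U; a \<in> U\<rbrakk> \<Longrightarrow> \<exists>y\<in>U. \<forall>x\<in>U. x \<E> y \<longleftrightarrow> x \<E> a \<and> sat p (e(0 := x))"
  and replacement:
    "\<lbrakk>range e \<subseteq> U; a \<in> U;
      \<forall>x\<in>U. x \<E> a \<longrightarrow> (\<exists>!y. y \<in> U \<and> sat p (e(0 := x, 1 := y)))\<rbrakk> \<Longrightarrow>
     \<exists>b\<in>U. \<forall>y\<in>U. y \<E> b \<longleftrightarrow> (\<exists>x\<in>U. x \<E> a \<and> sat p (e(0 := x, 1 := y)))"
  and choice:
    "\<lbrakk>a \<in> U; \<forall>x\<in>U. x \<E> a \<longrightarrow> (\<exists>z\<in>U. z \<E> x);
      \<forall>x\<in>U. \<forall>y\<in>U. x \<E> a \<and> y \<E> a \<and> x \<noteq> y \<longrightarrow> \<not> (\<exists>z\<in>U. z \<E> x \<and> z \<E> y)\<rbrakk> \<Longrightarrow>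
     \<exists>c\<in>U. \<forall>x\<in>U. x \<E> a \<longrightarrow> (\<exists>!z. z \<in> U \<and> z \<E> x \<and> z \<E> c)"


section \<open>Tiling equations inside a universe\<close>

text \<open>
  Everything below is the usual set-theoretic construction carried out inside the universe: all
  quantifiers over sets range over \<open>U\<close>. The group elements of the universe are kept as tuples of
  elements of \<open>U\<close> of standard length (the rank of the group being standard), and \<open>encode\<close> turns
  such a tuple into a single element of \<open>U\<close>.
\<close>

context set_structure
begin

definition ext :: "'u \<Rightarrow> 'u set" where
  "ext x = {y \<in> U. y \<E> x}"

definition collect :: "('u \<Rightarrow> bool) \<Rightarrow> 'u" where
  "collect P = (THE y. y \<in> U \<and> (\<forall>x\<in>U. x \<E> y \<longleftrightarrow> P x))"

definition empty :: 'u where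
  "empty = collect (\<lambda>x. False)"

definition succ :: "'u \<Rightarrow> 'u" where
  "succ n = collect (\<lambda>x. x \<E> n \<or> x = n)"

definition pair :: "'u \<Rightarrow> 'u \<Rightarrow> 'u" where
  "pair a b = collect (\<lambda>x. x = collect (\<lambda>y. y = a) \<or> x = collect (\<lambda>y. y = a \<or> y = b))"

definition omega :: 'u where
  "omega = collect (\<lambda>n. \<forall>I\<in>U. empty \<E> I \<and> (\<forall>x\<in>ext I. succ x \<E> I) \<longrightarrow> n \<E> I)"

text \<open>The standard natural numbers of the universe; \<open>omega\<close> may have further elements.\<close>

primrec num :: "nat \<Rightarrow> 'u" where
  "num 0 = empty"
| "num (Suc n) = succ (num n)"

text \<open>\<open>m + n\<close> by recursion on \<open>n\<close>: the value at \<open>n\<close> of the function \<open>h\<close> on \<open>omega\<close> (an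
  element of the universe) with \<open>h 0 = m\<close> and \<open>h (i + 1) = h i + 1\<close>.\<close>

definition nadd :: "'u \<Rightarrow> 'u \<Rightarrow> 'u" where
  "nadd m n = (THE k. k \<in> U \<and> (\<exists>h\<in>U.
     (\<forall>i\<in>ext omega. \<exists>!j. j \<in> U \<and> pair i j \<E> h) \<and>
     pair empty m \<E> h \<and>
     (\<forall>i\<in>ext omega. \<forall>j\<in>U. pair i j \<E> h \<longrightarrow> pair (succ i) (succ j) \<E> h) \<and>
     pair n k \<E> h))"

text \<open>The integer \<open>a - b\<close>, as an equivalence class of pairs of natural numbers.\<close>

definition zdiff :: "'u \<Rightarrow> 'u \<Rightarrow> 'u" where
  "zdiff a b = collect (\<lambda>p. \<exists>c\<in>ext omega. \<exists>d\<in>ext omega. p = pair c d \<and> nadd a d = nadd c b)"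

definition Z_in :: "'u monoid" where
  "Z_in =
     \<lparr>carrier = {zdiff a b | a b. a \<in> ext omega \<and> b \<in> ext omega},
      monoid.mult = (\<lambda>x y. THE z. \<exists>a\<in>ext omega. \<exists>b\<in>ext omega. \<exists>c\<in>ext omega. \<exists>d\<in>ext omega.
         x = zdiff a b \<and> y = zdiff c d \<and> z = zdiff (nadd a c) (nadd b d)),
      one = zdiff empty empty\<rparr>"

text \<open>The elements of the von Neumann numeral \<open>num N\<close> serve as the residues modulo \<open>N\<close>.\<close>

definition Zmod_in :: "nat \<Rightarrow> 'u monoid" where
  "Zmod_in N =
     \<lparr>carrier = ext (num N),
      monoid.mult = (\<lambda>a b. THE c. c \<in> ext (num N) \<and>
         (nadd a b = c \<or> nadd a b = nadd c (num N))),
      one = empty\<rparr>"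

definition Z_times_in :: "nat list \<Rightarrow> ('u \<times> (nat \<Rightarrow> 'u)) monoid" where
  "Z_times_in Ns = Z_in \<times>\<times> product_group {..<length Ns} (\<lambda>i. Zmod_in (Ns ! i))"

fun tuple :: "'u list \<Rightarrow> 'u" where
  "tuple [] = empty"
| "tuple (x # xs) = pair x (tuple xs)"

definition encode :: "nat list \<Rightarrow> 'u \<times> (nat \<Rightarrow> 'u) \<Rightarrow> 'u" where
  "encode Ns g = pair (fst g) (tuple (map (snd g) [0..<length Ns]))"

text \<open>The subset of the group of the universe given by an element of the universe.\<close>

definition subset_in :: "nat list \<Rightarrow> 'u \<Rightarrow> ('u \<times> (nat \<Rightarrow> 'u)) set" where
  "subset_in Ns x = {g \<in> carrier (Z_times_in Ns). encode Ns g \<E> x}"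

text \<open>The interpretation in the universe of a standard element of the group.\<close>

definition std :: "nat list \<Rightarrow> int \<times> (nat \<Rightarrow> int) \<Rightarrow> 'u \<times> (nat \<Rightarrow> 'u)" where
  "std Ns g =
     (zdiff (num (nat (fst g))) (num (nat (- fst g))),
      (\<lambda>i\<in>{..<length Ns}. num (nat (snd g i))))"

text \<open>
  The interpretation in the universe of a periodic set \<open>E\<close>. If \<open>E\<close> is a union of cosets of a
  subgroup of finite index in the group \<open>G\<close>, then it is a union of cosets of the finite-index
  subgroup of \<open>d\<close>-th powers (written additively, \<open>d G\<close>) for some standard \<open>d > 0\<close>; the universe
  interprets it as the union of the same cosets of the \<open>d\<close>-th powers in its own version of \<open>G\<close>.
  As \<open>d G\<close> has finite index, finitely many \<open>e \<in> E\<close> suffice here, so this is a first-order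
  definition. (Here \<open>[^]\<close> is the library's power with a standard exponent.)
\<close>

definition exponent_of :: "nat list \<Rightarrow> (int \<times> (nat \<Rightarrow> int)) set \<Rightarrow> nat" where
  "exponent_of Ns E = (LEAST d. 0 < d \<and>
     (\<forall>e\<in>E. \<forall>y\<in>carrier (Z_times Ns). e \<otimes>\<^bsub>Z_times Ns\<^esub> (y [^]\<^bsub>Z_times Ns\<^esub> d) \<in> E))"

definition periodic_in ::
  "nat list \<Rightarrow> (int \<times> (nat \<Rightarrow> int)) set \<Rightarrow> ('u \<times> (nat \<Rightarrow> 'u)) set" where
  "periodic_in Ns E =
     {std Ns e \<otimes>\<^bsub>Z_times_in Ns\<^esub> (y [^]\<^bsub>Z_times_in Ns\<^esub> exponent_of Ns E) | e y.
        e \<in> E \<and> y \<in> carrier (Z_times_in Ns)}"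

text \<open>The tiling equation has a solution in the universe: the unknown sets are given by elements
  of the universe.\<close>

definition solvable_in ::
  "nat list \<Rightarrow> nat \<Rightarrow> (nat \<Rightarrow> (int \<times> (nat \<Rightarrow> int)) set) \<Rightarrow> (int \<times> (nat \<Rightarrow> int)) set \<Rightarrow> bool" where
  "solvable_in Ns J F E \<longleftrightarrow>
     (\<exists>A :: nat \<Rightarrow> 'u. (\<forall>j\<in>{1..J}. A j \<in> U) \<and>
        tiling (Z_times_in Ns) J (\<lambda>j. std Ns ` F j) (periodic_in Ns E)
          (\<lambda>j. subset_in Ns (A j)))"

end

text \<open>
  Solutions exist in some universes of ZFC but not in others. Universes are taken with carrier
  inside an arbitrary type \<open>'u\<close>; by the Loewenheim-Skolem and completeness theorems this is, for
  every infinite \<open>'u\<close>, the same as the independence from ZFC of the sentence asserting that a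
  solution exists.
\<close>

definition undecidable_tile ::
  "'u itself \<Rightarrow> nat list \<Rightarrow> nat \<Rightarrow> (nat \<Rightarrow> (int \<times> (nat \<Rightarrow> int)) set) \<Rightarrow>
   (int \<times> (nat \<Rightarrow> int)) set \<Rightarrow> bool" where
  "undecidable_tile _ Ns J F E \<longleftrightarrow>
     (\<exists>(U :: 'u set) mem. zfc_universe U mem \<and> set_structure.solvable_in U mem Ns J F E) \<and>
     (\<exists>(U :: 'u set) mem. zfc_universe U mem \<and> \<not> set_structure.solvable_in U mem Ns J F E)"

abbreviation decidable_tile ::
  "'u itself \<Rightarrow> nat list \<Rightarrow> nat \<Rightarrow> (nat \<Rightarrow> (int \<times> (nat \<Rightarrow> int)) set) \<Rightarrow>
   (int \<times> (nat \<Rightarrow> int)) set \<Rightarrow> bool" where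
  "decidable_tile T Ns J F E \<equiv> \<not> undecidable_tile T Ns J F E"

end

theory Submission
  imports Defs "HOL-Algebra.Multiplicative_Group"
begin

text \<open>
  A tiling of a periodic subset of \<open>\<int> \<times> G\<^sub>0\<close> is a one-dimensional subshift of finite type, so the
  pigeonhole principle turns any solution into a periodic one; this excludes aperiodicity.

  For decidability, every universe of ZFC is shown to contain a solution exactly if there is one
  outside of it. The standard elements embed the group \<open>G\<close> into the group \<open>H\<close> of the
  universe in such a way that \<open>G/dG \<rightarrow> H/dH\<close> is an isomorphism for every standard \<open>d > 0\<close>. A
  solution in the universe restricts to the standard elements. Conversely, a \<open>d\<close>-periodic solution
  \<open>A\<close> extends to \<open>A + dH\<close>, which is an element of the universe as it is first-order definable.
\<close>

section \<open>Tilings of the integers times a finite group\<close>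

text \<open>\<open>omega\<close> may have nonstandard elements, and then the standard numerals do
  not form an element of the universe. Ordinary induction does not reach all of
  \<open>omega\<close>; only properties given by a formula can be induced over, which is why a
  calculus of definability precedes the arithmetic. The two transfers are asymmetric for the same
  reason. Restriction to the standard elements takes place outside, so any solution in the universe
  will do. Extension must produce an element of the universe, and an arbitrary solution from outside
  has no reason to be described there, whereas a periodic one is described by finitely many
  residues. The periodicity result that excludes aperiodicity is therefore also the engine of
  decidability. About the integers of the universe little has to be known beyond the group laws:
  division with remainder by a standard number, and that a standard integer divisible there by a
  standard number is divisible outside.\<close>

definition cover ::
  "('g, 'm) monoid_scheme \<Rightarrow> nat \<Rightarrow> (nat \<Rightarrow> 'g set) \<Rightarrow> (nat \<Rightarrow> 'g set) \<Rightarrow> 'g \<Rightarrow> (nat \<times> 'g) set" where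
  "cover G J F A g = (SIGMA j:{1..J}. {f \<in> F j. g \<otimes>\<^bsub>G\<^esub> inv\<^bsub>G\<^esub> f \<in> A j})"

lemma finite_cover: "\<forall>j\<in>{1..J}. finite (F j) \<Longrightarrow> finite (cover G J F A g)"
  by (auto simp: cover_def intro!: finite_SigmaI)

text \<open>Distinct sums, disjoint terms and exact covering are together one count:
  \<open>g\<close> has a single representation by the \<open>A j\<close> and \<open>F j\<close> if
  it lies in \<open>E\<close>, and none otherwise. In this form the equation at \<open>g\<close>
  depends on finitely many memberships only, which is what gets transported. Finite tiles matter
  because \<open>card\<close> of an infinite set is 0.\<close>

lemma (in group) tiling_iff_card_cover:
  assumes F: "\<forall>j\<in>{1..J}. finite (F j) \<and> F j \<subseteq> carrier G" and E: "E \<subseteq> carrier G"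
  shows "tiling G J F E A \<longleftrightarrow> (\<forall>j\<in>{1..J}. A j \<subseteq> carrier G) \<and>
    (\<forall>g\<in>carrier G. card (cover G J F A g) = (if g \<in> E then 1 else 0))" (is "_ \<longleftrightarrow> ?A \<and> ?C")
proof
  have fin: "finite (cover G J F A g)" for g
    using F by (intro finite_cover) auto
  have divide: "g \<otimes> inv f \<in> A j \<longleftrightarrow> (\<exists>a\<in>A j. g = a \<otimes> f)"
    if "g \<in> carrier G" "f \<in> carrier G" "A j \<subseteq> carrier G" for g f j
    using that by (metis inv_solve_right' subsetD)
  {
    assume "tiling G J F E A"
    then have A: ?A and inj: "\<And>j. j \<in> {1..J} \<Longrightarrow> inj_on (\<lambda>(x, f). x \<otimes> f) (A j \<times> F j)"
      and disj: "disjoint_family_on (\<lambda>j. A j <#> F j) {1..J}"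
      and E: "(\<Union>j\<in>{1..J}. A j <#> F j) = E"
      by (auto simp: tiling_def)
    have cover_iff: "(j, f) \<in> cover G J F A g \<longleftrightarrow> j \<in> {1..J} \<and> f \<in> F j \<and> (\<exists>a\<in>A j. g = a \<otimes> f)"
      if "g \<in> carrier G" for g j f
    proof (cases "j \<in> {1..J} \<and> f \<in> F j")
      case True
      then have "f \<in> carrier G" "A j \<subseteq> carrier G"
        using F A by blast+
      then show ?thesis
        using divide[OF that] True by (simp add: cover_def)
    qed (auto simp: cover_def)
    have "card (cover G J F A g) = (if g \<in> E then 1 else 0)" if g: "g \<in> carrier G" for g
    proof (cases "g \<in> E")
      case True
      then obtain j where j: "j \<in> {1..J}" "g \<in> A j <#> F j"
        using E by blast
      then obtain a f where f: "a \<in> A j" "f \<in> F j" "g = a \<otimes> f"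
        by (auto simp: set_mult_def)
      have "p = (j, f)" if p: "p \<in> cover G J F A g" for p
      proof -
        obtain i e b where i: "p = (i, e)" "i \<in> {1..J}" "e \<in> F i" "b \<in> A i" "g = b \<otimes> e"
          using p cover_iff[OF g] by (cases p) auto
        have "g \<in> A i <#> F i"
          using i by (auto simp: set_mult_def)
        then have "i = j"
          using disj j i(2) unfolding disjoint_family_on_def by blast
        moreover have "(b, e) = (a, f)"
          using inj[OF j(1)] i f unfolding \<open>i = j\<close> inj_on_def by (metis (lifting) SigmaI case_prod_conv)
        ultimately show ?thesis
          using i(1) by simp
      qed
      moreover have "(j, f) \<in> cover G J F A g"
        using cover_iff[OF g] j(1) f by blast
      ultimately have "cover G J F A g = {(j, f)}"
        by blast
      then show ?thesis
        using True by simp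
    next
      case False
      have "g \<in> E" if "(j, f) \<in> cover G J F A g" for j f
      proof -
        have "j \<in> {1..J}" "g \<in> A j <#> F j"
          using that cover_iff[OF g] by (auto simp: set_mult_def)
        then show ?thesis
          using E by blast
      qed
      then have "cover G J F A g = {}"
        using False by auto
      then show ?thesis
        using False by simp
    qed
    with A show "?A \<and> ?C"
      by blast
  }
  {
    assume "?A \<and> ?C"
    then have A: ?A and C: ?C
      by blast+
    have mem: "(j, f) \<in> cover G J F A (a \<otimes> f)" "a \<otimes> f \<in> E" "a \<otimes> f \<in> carrier G" "a = (a \<otimes> f) \<otimes> inv f"
      if "j \<in> {1..J}" "a \<in> A j" "f \<in> F j" for j a f
    proof -
      have c: "a \<in> carrier G" "f \<in> carrier G"
        using that A F by blast+
      then show *: "a = (a \<otimes> f) \<otimes> inv f" and af: "a \<otimes> f \<in> carrier G"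
        by (simp_all add: m_assoc)
      then show cov: "(j, f) \<in> cover G J F A (a \<otimes> f)"
        using that by (simp add: cover_def)
      show "a \<otimes> f \<in> E"
        using C af cov fin[of "a \<otimes> f"] by (metis card_0_eq empty_iff)
    qed
    have unique: "p = q" if "g \<in> carrier G" "p \<in> cover G J F A g" "q \<in> cover G J F A g" for g p q
    proof -
      have "card (cover G J F A g) \<le> 1"
        using C that(1) by simp
      then show ?thesis
        using fin that(2,3) by (auto simp: card_le_Suc0_iff_eq)
    qed
    have eq: "i = j \<and> a = b \<and> e = f"
      if "i \<in> {1..J}" "a \<in> A i" "e \<in> F i" "j \<in> {1..J}" "b \<in> A j" "f \<in> F j" "a \<otimes> e = b \<otimes> f" for i j a b e f
    proof -
      have "(i, e) = (j, f)"
        using unique[OF mem(3,1)[OF that(1-3)]] mem(1)[OF that(4-6)] that(7) by simp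
      then show ?thesis
        using mem(4)[OF that(1-3)] mem(4)[OF that(4-6)] that(7) by auto
    qed
    have "inj_on (\<lambda>(x, f). x \<otimes> f) (A j \<times> F j)" if "j \<in> {1..J}" for j
      using eq[OF that _ _ that] by (auto simp: inj_on_def)
    moreover have "disjoint_family_on (\<lambda>j. A j <#> F j) {1..J}"
      unfolding disjoint_family_on_def set_mult_def using eq by blast
    moreover have "(\<Union>j\<in>{1..J}. A j <#> F j) = E"
    proof
      show "(\<Union>j\<in>{1..J}. A j <#> F j) \<subseteq> E"
        using mem(2) by (auto simp: set_mult_def)
      show "E \<subseteq> (\<Union>j\<in>{1..J}. A j <#> F j)"
      proof
        fix g assume g: "g \<in> E"
        then have "g \<in> carrier G"
          using E by blast
        then have "cover G J F A g \<noteq> {}"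
          using C g by force
        then obtain j f where "j \<in> {1..J}" "f \<in> F j" "g \<otimes> inv f \<in> A j"
          unfolding cover_def by blast
        moreover then have "f \<in> carrier G"
          using F by blast
        then have "g = (g \<otimes> inv f) \<otimes> f"
          using \<open>g \<in> carrier G\<close> by (simp add: m_assoc)
        ultimately show "g \<in> (\<Union>j\<in>{1..J}. A j <#> F j)"
          unfolding set_mult_def by blast
      qed
    qed
    ultimately show "tiling G J F E A"
      using A by (simp add: tiling_def)
  }
qed

text \<open>The form with \<open>\<sigma>\<close> serves two comparisons: \<open>\<sigma>\<close> is
  \<open>id\<close> when two points of one group are compared for different sets, and the embedding
  when a group is compared with a larger one.\<close>

lemma card_cover_eq:
  assumes "\<And>j. j \<in> {1..J} \<Longrightarrow> inj_on \<sigma> (F j)"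
    and "\<And>j f. j \<in> {1..J} \<Longrightarrow> f \<in> F j \<Longrightarrow>
      h \<otimes>\<^bsub>H\<^esub> inv\<^bsub>H\<^esub> (\<sigma> f) \<in> B j \<longleftrightarrow> g \<otimes>\<^bsub>G\<^esub> inv\<^bsub>G\<^esub> f \<in> A j"
  shows "card (cover H J (\<lambda>j. \<sigma> ` F j) B h) = card (cover G J F A g)"
proof -
  have "cover H J (\<lambda>j. \<sigma> ` F j) B h = map_prod id \<sigma> ` cover G J F A g"
    using assms(2) by (force simp: cover_def)
  moreover have "inj_on (map_prod id \<sigma>) (cover G J F A g)"
    using assms(1) by (auto simp: cover_def inj_on_def)
  ultimately show ?thesis
    by (simp add: card_image)
qed

text \<open>Invariance under the subgroup of d-th powers, without naming a subgroup: an exponent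
  makes sense in every group, so the condition can be compared across groups.\<close>

definition power_closed :: "('g, 'm) monoid_scheme \<Rightarrow> nat \<Rightarrow> 'g set \<Rightarrow> bool" where
  "power_closed G d S \<longleftrightarrow> S \<subseteq> carrier G \<and> (\<forall>a\<in>S. \<forall>y\<in>carrier G. a \<otimes>\<^bsub>G\<^esub> (y [^]\<^bsub>G\<^esub> d) \<in> S)"

text \<open>The exponent is the index of \<open>H\<close>: by Lagrange in the quotient, every power
  with this exponent lies in \<open>H\<close>, and multiplication by elements of \<open>H\<close>
  preserves each coset.\<close>

lemma (in comm_group) periodic_set_imp_power_closed:
  assumes "periodic_set G S"
  shows "\<exists>d>0. power_closed G d S"
proof -
  obtain H C where H: "subgroup H G" "finite (rcosets H)" "C \<subseteq> rcosets H" "S = \<Union>C"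
    using assms unfolding periodic_set_def by blast
  then interpret normal H G
    by (simp add: subgroup_imp_normal)
  interpret Q: group "G Mod H"
    by (rule factorgroup_is_group)
  have fin: "finite (carrier (G Mod H))"
    using H(2) by (simp add: FactGroup_def)
  let ?d = "order (G Mod H)"
  have pow: "y [^] ?d \<in> H" if "y \<in> carrier G" for y
  proof -
    have hom: "(\<lambda>a. H #> a) \<in> hom G (G Mod H)"
      by (rule r_coset_hom_Mod)
    have "H #> (y [^] ?d) = (H #> y) [^]\<^bsub>G Mod H\<^esub> ?d"
      by (rule hom_nat_pow[OF hom that is_group Q.is_group])
    also have "\<dots> = H"
      using Q.pow_order_eq_1[of "H #> y"] that by (simp add: FactGroup_def RCOSETS_def) blast
    finally show ?thesis
      using rcos_self[OF nat_pow_closed[OF that, of ?d] subgroup_axioms] by simp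
  qed
  have "S \<subseteq> carrier G"
    using H(3,4) rcosets_carrier[OF is_group] by blast
  moreover have "a \<otimes> (y [^] ?d) \<in> S" if a: "a \<in> S" and y: "y \<in> carrier G" for a y
  proof -
    obtain K where "K \<in> C" "a \<in> K"
      using a H(4) by blast
    moreover then obtain b where "b \<in> carrier G" "K = H #> b"
      using H(3) unfolding RCOSETS_def by blast
    ultimately have b: "b \<in> carrier G" "a \<in> H #> b" "H #> b \<subseteq> S"
      using H(4) by auto
    then obtain h where h: "h \<in> H" "a = h \<otimes> b"
      by (auto simp: r_coset_def)
    have "a \<otimes> (y [^] ?d) = (h \<otimes> y [^] ?d) \<otimes> b"
      using h b y by (simp add: m_ac)
    also have "\<dots> \<in> H #> b"
      using h(1) pow[OF y] by (auto simp: r_coset_def)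
    finally show ?thesis
      using b by blast
  qed
  ultimately show ?thesis
    using Q.order_gt_0_iff_finite fin by (auto simp: power_closed_def)
qed

section \<open>Periodic tilings of the integers times a finite commutative group\<close>

locale finite_times_int = P: comm_group P for P (structure) +
  assumes finite_P: "finite (carrier P)"
begin

definition ZP where "ZP = integer_group \<times>\<times> P"

sublocale G: comm_group ZP
proof -
  interpret group "integer_group \<times>\<times> P"
    by (rule DirProd_group) auto
  show "comm_group ZP"
    unfolding ZP_def by (rule group_comm_groupI) (auto simp: P.m_comm)
qed

lemma carrier_ZP [simp]: "carrier ZP = UNIV \<times> carrier P"
  by (simp add: ZP_def)

lemma mult_ZP [simp]: "(x, s) \<otimes>\<^bsub>ZP\<^esub> (y, t) = (x + y, s \<otimes> t)"
  by (simp add: ZP_def)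

lemma inv_ZP [simp]: "s \<in> carrier P \<Longrightarrow> inv\<^bsub>ZP\<^esub> (x, s) = (- x, inv s)"
  by (simp add: ZP_def)

lemma one_ZP [simp]: "\<one>\<^bsub>ZP\<^esub> = (0, \<one>)"
  by (simp add: ZP_def)

lemma pow_ZP [simp]: "(x, s) [^]\<^bsub>ZP\<^esub> (n :: nat) = (int n * x, s [^] n)"
  by (induction n) (auto simp: algebra_simps)

text \<open>The d-th power of \<open>(k, \<one>)\<close> is \<open>(d k, \<one>)\<close>, so
  \<open>S\<close> has period \<open>d\<close> in the integer coordinate.\<close>

lemma power_closed_shift:
  assumes "power_closed ZP d S" "int d dvd y - x" "t \<in> carrier P"
  shows "(x, t) \<in> S \<longleftrightarrow> (y, t) \<in> S"
proof -
  have step: "(x + int d * k, t) \<in> S" if "(x, t) \<in> S" for x k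
  proof -
    have "(x, t) \<otimes>\<^bsub>ZP\<^esub> (k, \<one>) [^]\<^bsub>ZP\<^esub> d \<in> S"
      using assms(1) that by (auto simp: power_closed_def simp del: pow_ZP)
    then show ?thesis
      using assms(3) by simp
  qed
  obtain k where "y = x + int d * k"
    using assms(2) by (metis add.commute diff_add_cancel dvdE)
  then show ?thesis
    using step[of x k] step[of y "- k"] by auto
qed

text \<open>The d-th powers have finite index: every coset has a representative with integer
  coordinate in \<open>{0..<int d}\<close>, and the other coordinate ranges over a finite
  set.\<close>

lemma power_closed_imp_periodic_set:
  assumes "power_closed ZP d S" "0 < d"
  shows "periodic_set ZP S"
proof -
  let ?H = "{y [^]\<^bsub>ZP\<^esub> d | y. y \<in> carrier ZP}"
  have H: "subgroup ?H ZP"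
  proof (rule G.subgroupI)
    show "a \<in> ?H \<Longrightarrow> inv\<^bsub>ZP\<^esub> a \<in> ?H" for a
      using G.nat_pow_inv G.inv_closed by (smt (verit) mem_Collect_eq)
    show "a \<in> ?H \<Longrightarrow> b \<in> ?H \<Longrightarrow> a \<otimes>\<^bsub>ZP\<^esub> b \<in> ?H" for a b
      using G.nat_pow_distrib G.m_closed by (smt (verit) mem_Collect_eq)
    show "?H \<noteq> {}"
      using G.one_closed by blast
  qed (auto simp del: carrier_ZP pow_ZP)
  have eq: "?H #>\<^bsub>ZP\<^esub> (x, t) = ?H #>\<^bsub>ZP\<^esub> (x mod int d, t)" if t: "t \<in> carrier P" for x t
  proof (rule G.repr_independence[OF _ _ H])
    have "(- (x div int d), \<one>) [^]\<^bsub>ZP\<^esub> d \<otimes>\<^bsub>ZP\<^esub> (x, t) = (x mod int d, t)"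
      using t by (simp add: minus_mult_div_eq_mod)
    moreover have "(- (x div int d), \<one>) [^]\<^bsub>ZP\<^esub> d \<in> ?H"
      by (auto simp del: pow_ZP)
    ultimately show "(x mod int d, t) \<in> ?H #>\<^bsub>ZP\<^esub> (x, t)"
      unfolding r_coset_def by force
  qed (use t in auto)
  have "rcosets\<^bsub>ZP\<^esub> ?H \<subseteq> (\<lambda>a. ?H #>\<^bsub>ZP\<^esub> a) ` ({0..<int d} \<times> carrier P)"
  proof
    fix K assume "K \<in> rcosets\<^bsub>ZP\<^esub> ?H"
    then obtain x t where xt: "t \<in> carrier P" "K = ?H #>\<^bsub>ZP\<^esub> (x, t)"
      by (auto simp: RCOSETS_def simp del: pow_ZP)
    then show "K \<in> (\<lambda>a. ?H #>\<^bsub>ZP\<^esub> a) ` ({0..<int d} \<times> carrier P)"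
      using eq[OF xt(1), of x] assms(2) by (intro image_eqI[of _ _ "(x mod int d, t)"]) auto
  qed
  then have fin: "finite (rcosets\<^bsub>ZP\<^esub> ?H)"
    by (rule finite_subset) (simp add: finite_P)
  have S: "S \<subseteq> carrier ZP"
    using assms(1) by (simp add: power_closed_def)
  let ?C = "(\<lambda>a. ?H #>\<^bsub>ZP\<^esub> a) ` S"
  have C: "?C \<subseteq> rcosets\<^bsub>ZP\<^esub> ?H"
    using S by (auto simp: RCOSETS_def simp del: pow_ZP)
  have "S = \<Union>?C"
  proof
    show "S \<subseteq> \<Union>?C"
      using G.rcos_self[OF _ H] S by blast
    show "\<Union>?C \<subseteq> S"
    proof
      fix z assume "z \<in> \<Union>?C"
      then obtain a y where ay: "a \<in> S" "y \<in> carrier ZP" and z: "z = y [^]\<^bsub>ZP\<^esub> d \<otimes>\<^bsub>ZP\<^esub> a"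
        unfolding r_coset_def by blast
      have "a \<otimes>\<^bsub>ZP\<^esub> y [^]\<^bsub>ZP\<^esub> d \<in> S"
        using ay assms(1) unfolding power_closed_def by blast
      moreover have "z = a \<otimes>\<^bsub>ZP\<^esub> y [^]\<^bsub>ZP\<^esub> d"
        unfolding z using ay S by (intro G.m_comm) auto
      ultimately show "z \<in> S"
        by (simp only:)
    qed
  qed
  then show ?thesis
    using H fin C finite_subset[OF C fin] unfolding periodic_set_def by blast
qed

lemma bounded_tiles:
  fixes J :: nat
  assumes "\<forall>j\<in>{1..J}. finite (F j)"
  obtains L :: nat where "\<And>j u s. j \<in> {1..J} \<Longrightarrow> (u, s) \<in> F j \<Longrightarrow> \<bar>u\<bar> \<le> int L"
proof
  let ?S = "(\<lambda>p. nat \<bar>fst p\<bar>) ` (\<Union>j\<in>{1..J}. F j)"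
  fix j u s assume "j \<in> {1..J}" "(u, s) \<in> F j"
  then have "nat \<bar>u\<bar> \<in> ?S"
    by force
  then have "nat \<bar>u\<bar> \<le> Max ?S"
    using assms by (intro Max_ge finite_imageI finite_UN_I) auto
  then show "\<bar>u\<bar> \<le> int (Max ?S)"
    by simp
qed

text \<open>Two of the windows of radius \<open>L\<close> around the multiples of a large step agree, by the pigeonhole
  principle; repeating the stretch between them changes no window of radius \<open>L\<close>.\<close>

lemma tiling_imp_power_closed_tiling:
  assumes F: "\<forall>j\<in>{1..J}. finite (F j) \<and> F j \<subseteq> carrier ZP"
    and E: "power_closed ZP d E" "0 < d" and A: "tiling ZP J F E A"
  obtains D B where "0 < D" "d dvd D" "tiling ZP J F E B" "\<And>j. power_closed ZP D (B j)"
proof -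
  have EG: "E \<subseteq> carrier ZP"
    using E by (simp add: power_closed_def)
  obtain L where L: "\<And>j u s. j \<in> {1..J} \<Longrightarrow> (u, s) \<in> F j \<Longrightarrow> \<bar>u\<bar> \<le> int L"
    using bounded_tiles[of J F] F by blast
  \<comment> \<open>The factor \<open>d\<close> keeps shifts by multiples of \<open>K\<close> from
    changing \<open>E\<close>. The factor \<open>order P\<close> makes D-th powers trivial in
    \<open>P\<close> later on, so that only the integer coordinate has to be made periodic. The
    factor \<open>L + 1\<close> makes a period longer than any tile reaches.\<close>
  define K where "K = d * order P * (L + 1)"
  have "0 < order P"
    using P.order_gt_0_iff_finite finite_P by simp
  then have "0 < d * order P"
    using E(2) by simp
  then have "1 * (L + 1) \<le> K"
    unfolding K_def by (intro mult_le_mono1) simp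
  then have K: "0 < K" "L \<le> K"
    by simp_all
  define W where "W = {1..J} \<times> {- int L..int L} \<times> carrier P"
  \<comment> \<open>The trace of \<open>A\<close> on the window of radius \<open>L\<close> around
    \<open>n * K\<close>, moved to the origin. As a subset of the finite set \<open>W\<close> it
    takes finitely many values.\<close>
  define s where "s n = {(j, u, t) \<in> W. (int (n * K) + u, t) \<in> A j}" for n :: nat
  have "\<not> inj s"
  proof
    assume "inj s"
    have "finite (range s)"
      by (rule finite_subset[of _ "Pow W"]) (auto simp: s_def W_def finite_P)
    then show False
      using \<open>inj s\<close> finite_imageD by blast
  qed
  then obtain n m where nm: "n < m" "s n = s m"
    unfolding inj_def by (metis linorder_neqE_nat)
  \<comment> \<open>\<open>p\<close> is the centre of the first of the two equal windows,
    \<open>D\<close> the distance to the second.\<close>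
  define p where "p = int (n * K)"
  define D where "D = (m - n) * K"
  have "K \<le> D"
    unfolding D_def using nm(1) by (cases "m - n") auto
  then have D: "int D = int (m * K) - p" "L \<le> D" "0 < D"
    using nm(1) K by (auto simp: D_def p_def of_nat_diff algebra_simps)
  have window: "(p + u, t) \<in> A j \<longleftrightarrow> (p + int D + u, t) \<in> A j"
    if "j \<in> {1..J}" "\<bar>u\<bar> \<le> int L" "t \<in> carrier P" for j u t
  proof -
    have "(j, u, t) \<in> s n \<longleftrightarrow> (j, u, t) \<in> s m"
      using nm(2) by simp
    then show ?thesis
      using that D(1) by (auto simp: s_def W_def p_def)
  qed
  \<comment> \<open>The stretch of \<open>A\<close> with integer coordinates from \<open>p\<close>
    to \<open>p + D - 1\<close>, repeated with period \<open>D\<close>.\<close>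
  define B where "B j = {(x, t). t \<in> carrier P \<and> (p + (x - p) mod int D, t) \<in> A j}" for j
  \<comment> \<open>Up to distance \<open>L\<close>, \<open>B\<close> around \<open>x\<close> looks
    like \<open>A\<close> around the reduced point. If \<open>u\<close> leads out of the stretch,
    reduction moves the argument by \<open>D\<close> to one side, and the equality of the two
    windows undoes this. As \<open>L \<le> D\<close>, one correction is enough.\<close>
  have local: "(x + u, t) \<in> B j \<longleftrightarrow> (p + (x - p) mod int D + u, t) \<in> A j"
    if "j \<in> {1..J}" "\<bar>u\<bar> \<le> int L" "t \<in> carrier P" for j x u t
  proof -
    define r where "r = (x - p) mod int D"
    have r: "0 \<le> r" "r < int D"
      using D(3) by (auto simp: r_def)
    have mod: "(x + u - p) mod int D = (r + u) mod int D"
    proof -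
      have "x + u - p = (x - p) + u" by simp
      then show ?thesis by (simp only: r_def mod_add_left_eq)
    qed
    consider "0 \<le> r + u" "r + u < int D" | "r + u < 0" | "int D \<le> r + u"
      by linarith
    then have "(p + (r + u) mod int D, t) \<in> A j \<longleftrightarrow> (p + r + u, t) \<in> A j"
    proof cases
      case 1
      then show ?thesis by (simp add: add.assoc)
    next
      case 2
      then have "(r + u) mod int D = r + u + int D"
        using r that(2) D(2) by (intro mod_pos_pos_trivial[of "r + u + int D" "int D", simplified]) auto
      then show ?thesis
        using window[of j "r + u" t] that 2 r by (simp add: algebra_simps)
    next
      case 3
      then have eq: "(r + u) mod int D = r + u - int D"
        using r that(2) D(2) mod_pos_pos_trivial[of "r + u - int D" "int D"] by simp
      show ?thesis
        unfolding eq
        using window[of j "r + u - int D" t] that 3 r by (simp add: algebra_simps)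
    qed
    then show ?thesis
      using that by (simp add: B_def mod r_def)
  qed
  have "tiling ZP J F E B"
    unfolding G.tiling_iff_card_cover[OF F EG]
  proof (intro conjI ballI)
    show "B j \<subseteq> carrier ZP" for j
      by (auto simp: B_def)
    fix g assume "g \<in> carrier ZP"
    then obtain x t where g: "g = (x, t)" "t \<in> carrier P"
      by auto
    let ?q = "p + (x - p) mod int D"
    \<comment> \<open>Tiles reach at most \<open>L\<close>, so the count for \<open>B\<close> at
      \<open>x\<close> is the count for \<open>A\<close> at the reduced point.\<close>
    have "card (cover ZP J (\<lambda>j. id ` F j) B g) = card (cover ZP J F A (?q, t))"
    proof (rule card_cover_eq)
      fix j f assume j: "j \<in> {1..J}" "f \<in> F j"
      then have "f \<in> carrier ZP"
        using F by blast
      then obtain u v where f: "f = (u, v)" "v \<in> carrier P"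
        by auto
      have "\<bar>- u\<bar> \<le> int L"
        using L j f by auto
      from local[OF j(1) this, of "t \<otimes> inv v" x]
      show "g \<otimes>\<^bsub>ZP\<^esub> inv\<^bsub>ZP\<^esub> id f \<in> B j \<longleftrightarrow> (?q, t) \<otimes>\<^bsub>ZP\<^esub> inv\<^bsub>ZP\<^esub> f \<in> A j"
        using f g by simp
    qed auto
    moreover have "g \<in> E \<longleftrightarrow> (?q, t) \<in> E"
      unfolding g(1)
    proof (rule power_closed_shift[OF E(1) _ g(2)])
      have "int d dvd int D"
        by (simp add: D_def K_def)
      then show "int d dvd ?q - x"
        by (metis (no_types, opaque_lifting) add.commute add_diff_cancel_left' diff_diff_eq2 dvd_minus_mod dvd_trans minus_diff_eq dvd_minus_iff)
    qed
    ultimately show "card (cover ZP J F B g) = (if g \<in> E then 1 else 0)"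
      using A g(2) unfolding G.tiling_iff_card_cover[OF F EG] by simp
  qed
  moreover have "power_closed ZP D (B j)" for j
  proof -
    have "(x, t) \<otimes>\<^bsub>ZP\<^esub> ((y, v) [^]\<^bsub>ZP\<^esub> D) \<in> B j" if "(x, t) \<in> B j" "v \<in> carrier P" for x t y v
    proof -
      \<comment> \<open>A D-th power shifts the integer coordinate by a multiple of \<open>D\<close>
        and is trivial in \<open>P\<close>, because \<open>D\<close> is a multiple of the order of
        \<open>P\<close>.\<close>
      have "D = order P * ((m - n) * d * (L + 1))"
        by (simp only: D_def K_def mult_ac)
      then have "v [^] D = (v [^] order P) [^] ((m - n) * d * (L + 1))"
        using that(2) by (simp only: P.nat_pow_pow)
      then have "v [^] D = \<one>"
        using P.pow_order_eq_1[OF that(2)] by simp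
      moreover have "(x + int D * y - p) mod int D = (x - p) mod int D"
        by (simp add: mod_eq_dvd_iff)
      ultimately show ?thesis
        using that by (simp add: B_def)
    qed
    then show ?thesis
      by (auto simp: power_closed_def B_def simp del: pow_ZP mult_ZP)
  qed
  ultimately show thesis
    using that[of D B] D(3) by (simp add: D_def K_def)
qed

end

section \<open>Pure embeddings\<close>

text \<open>\<open>dense\<close> and \<open>pure\<close> are the surjectivity and the injectivity of
  the map from \<open>G\<close> modulo d-th powers to \<open>H\<close> modulo d-th powers; the
  second says that the image is a pure subgroup. The exponent is a number of HOL, hence standard
  even if \<open>H\<close> comes from a nonstandard universe.\<close>

locale pure_embedding = G: comm_group G + H: comm_group H
  for G :: "('g, 'm) monoid_scheme" and H :: "('h, 'n) monoid_scheme" +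
  fixes \<sigma> :: "'g \<Rightarrow> 'h"
  assumes hom: "\<sigma> \<in> hom G H" and inj: "inj_on \<sigma> (carrier G)"
    and dense: "h \<in> carrier H \<Longrightarrow> 0 < d \<Longrightarrow>
      \<exists>g\<in>carrier G. \<exists>y\<in>carrier H. h = \<sigma> g \<otimes>\<^bsub>H\<^esub> y [^]\<^bsub>H\<^esub> (d :: nat)"
    and pure: "g \<in> carrier G \<Longrightarrow> y \<in> carrier H \<Longrightarrow> \<sigma> g = y [^]\<^bsub>H\<^esub> d \<Longrightarrow> 0 < d \<Longrightarrow>
      \<exists>x\<in>carrier G. g = x [^]\<^bsub>G\<^esub> d"
begin

sublocale group_hom G H \<sigma>
  by unfold_locales (rule hom)

text \<open>The union of the classes modulo d-th powers that meet the image of \<open>S\<close>. For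
  \<open>E\<close> and its exponent this is literally \<open>periodic_in\<close>; solutions are
  extended in the same way.\<close>

definition spread :: "nat \<Rightarrow> 'g set \<Rightarrow> 'h set" where
  "spread d S = {\<sigma> a \<otimes>\<^bsub>H\<^esub> y [^]\<^bsub>H\<^esub> d | a y. a \<in> S \<and> y \<in> carrier H}"

text \<open>If \<open>\<sigma> g\<close> times the d-th power of \<open>y\<close> equals
  \<open>\<sigma> a\<close> times that of \<open>z\<close>, then \<open>\<sigma>\<close> maps the
  quotient of \<open>g\<close> by \<open>a\<close> to a d-th power. By purity this quotient is a
  d-th power in \<open>G\<close> already, so \<open>g\<close> is in \<open>S\<close> along with
  \<open>a\<close>. Together with \<open>dense\<close>, every membership in a spread set can be read
  off in \<open>G\<close>.\<close>

lemma mem_spread_iff: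
  assumes S: "power_closed G d S" and "0 < d" and g: "g \<in> carrier G" and y: "y \<in> carrier H"
  shows "\<sigma> g \<otimes>\<^bsub>H\<^esub> y [^]\<^bsub>H\<^esub> d \<in> spread d S \<longleftrightarrow> g \<in> S"
proof
  assume "\<sigma> g \<otimes>\<^bsub>H\<^esub> y [^]\<^bsub>H\<^esub> d \<in> spread d S"
  then obtain a z where a: "a \<in> S" "z \<in> carrier H"
    and eq: "\<sigma> g \<otimes>\<^bsub>H\<^esub> y [^]\<^bsub>H\<^esub> d = \<sigma> a \<otimes>\<^bsub>H\<^esub> z [^]\<^bsub>H\<^esub> d"
    unfolding spread_def by blast
  have aG: "a \<in> carrier G"
    using a(1) S by (auto simp: power_closed_def)
  have cancel: "\<sigma> a \<otimes>\<^bsub>H\<^esub> (inv\<^bsub>H\<^esub> \<sigma> a \<otimes>\<^bsub>H\<^esub> w) = w" if "w \<in> carrier H" for w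
    using aG that by (simp flip: H.m_assoc)
  have "\<sigma> (g \<otimes>\<^bsub>G\<^esub> inv\<^bsub>G\<^esub> a) = \<sigma> g \<otimes>\<^bsub>H\<^esub> inv\<^bsub>H\<^esub> \<sigma> a"
    using g aG by simp
  also have "\<sigma> g = (\<sigma> a \<otimes>\<^bsub>H\<^esub> z [^]\<^bsub>H\<^esub> d) \<otimes>\<^bsub>H\<^esub> inv\<^bsub>H\<^esub> (y [^]\<^bsub>H\<^esub> d)"
    using g y aG a(2) by (simp flip: eq add: H.m_assoc)
  also have "(\<sigma> a \<otimes>\<^bsub>H\<^esub> z [^]\<^bsub>H\<^esub> d) \<otimes>\<^bsub>H\<^esub> inv\<^bsub>H\<^esub> (y [^]\<^bsub>H\<^esub> d) \<otimes>\<^bsub>H\<^esub> inv\<^bsub>H\<^esub> \<sigma> a =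
      z [^]\<^bsub>H\<^esub> d \<otimes>\<^bsub>H\<^esub> inv\<^bsub>H\<^esub> (y [^]\<^bsub>H\<^esub> d)"
    using y aG a(2) by (simp add: H.m_ac cancel)
  also have "\<dots> = (z \<otimes>\<^bsub>H\<^esub> inv\<^bsub>H\<^esub> y) [^]\<^bsub>H\<^esub> d"
    using y a(2) by (simp add: H.nat_pow_distrib H.nat_pow_inv)
  finally obtain x where x: "x \<in> carrier G" "g \<otimes>\<^bsub>G\<^esub> inv\<^bsub>G\<^esub> a = x [^]\<^bsub>G\<^esub> d"
    using pure[of "g \<otimes>\<^bsub>G\<^esub> inv\<^bsub>G\<^esub> a" "z \<otimes>\<^bsub>H\<^esub> inv\<^bsub>H\<^esub> y" d] g aG y a(2) assms(2) by auto
  have "g = a \<otimes>\<^bsub>G\<^esub> (g \<otimes>\<^bsub>G\<^esub> inv\<^bsub>G\<^esub> a)"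
    using g aG by (simp add: G.m_comm[of a "g \<otimes>\<^bsub>G\<^esub> inv\<^bsub>G\<^esub> a"] G.m_assoc)
  then show "g \<in> S"
    using x a(1) S unfolding power_closed_def by metis
qed (use y in \<open>auto simp: spread_def\<close>)

lemma spread_subset: "S \<subseteq> carrier G \<Longrightarrow> spread d S \<subseteq> carrier H"
  by (auto simp: spread_def)

lemma image_mem_spread_iff:
  assumes "power_closed G d S" "0 < d" "g \<in> carrier G"
  shows "\<sigma> g \<in> spread d S \<longleftrightarrow> g \<in> S"
  using mem_spread_iff[OF assms H.one_closed] assms(3) by simp

context
  fixes J :: nat and F :: "nat \<Rightarrow> 'g set" and E :: "'g set" and d :: nat
  assumes F: "\<forall>j\<in>{1..J}. finite (F j) \<and> F j \<subseteq> carrier G"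
    and E: "power_closed G d E" "0 < d"
begin

lemma tiling_G_iff: "tiling G J F E A \<longleftrightarrow> (\<forall>j\<in>{1..J}. A j \<subseteq> carrier G) \<and>
    (\<forall>g\<in>carrier G. card (cover G J F A g) = (if g \<in> E then 1 else 0))"
  by (rule G.tiling_iff_card_cover[OF F]) (use E in \<open>auto simp: power_closed_def\<close>)

lemma tiling_H_iff: "tiling H J (\<lambda>j. \<sigma> ` F j) (spread d E) B \<longleftrightarrow> (\<forall>j\<in>{1..J}. B j \<subseteq> carrier H) \<and>
    (\<forall>h\<in>carrier H. card (cover H J (\<lambda>j. \<sigma> ` F j) B h) = (if h \<in> spread d E then 1 else 0))"
proof (rule H.tiling_iff_card_cover)
  show "\<forall>j\<in>{1..J}. finite (\<sigma> ` F j) \<and> \<sigma> ` F j \<subseteq> carrier H"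
    using F hom_closed by blast
  show "spread d E \<subseteq> carrier H"
    using E(1) by (intro spread_subset) (auto simp: power_closed_def)
qed

lemma inj_on_tile: "j \<in> {1..J} \<Longrightarrow> inj_on \<sigma> (F j)"
  using F inj inj_on_subset by blast

text \<open>At a point \<open>\<sigma> g\<close> all quotients by tile elements stay in the image of
  \<open>\<sigma>\<close>, so only the trace of \<open>B\<close> on this image is seen. That trace
  is formed outside the universe, so \<open>B\<close> may be any solution.\<close>

lemma tiling_pull_back:
  assumes "tiling H J (\<lambda>j. \<sigma> ` F j) (spread d E) B"
  shows "tiling G J F E (\<lambda>j. {g \<in> carrier G. \<sigma> g \<in> B j})"
  unfolding tiling_G_iff
proof (intro conjI ballI)
  fix g assume g: "g \<in> carrier G"
  have "card (cover H J (\<lambda>j. \<sigma> ` F j) B (\<sigma> g)) = card (cover G J F (\<lambda>j. {g \<in> carrier G. \<sigma> g \<in> B j}) g)"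
  proof (rule card_cover_eq)
    fix j f assume "j \<in> {1..J}" "f \<in> F j"
    then have "f \<in> carrier G"
      using F by blast
    then show "\<sigma> g \<otimes>\<^bsub>H\<^esub> inv\<^bsub>H\<^esub> \<sigma> f \<in> B j \<longleftrightarrow>
        g \<otimes>\<^bsub>G\<^esub> inv\<^bsub>G\<^esub> f \<in> {g \<in> carrier G. \<sigma> g \<in> B j}"
      using g by simp
  qed (rule inj_on_tile)
  then show "card (cover G J F (\<lambda>j. {g \<in> carrier G. \<sigma> g \<in> B j}) g) = (if g \<in> E then 1 else 0)"
    using assms g image_mem_spread_iff[OF E g] unfolding tiling_H_iff by simp
qed blast

text \<open>If \<open>h\<close> is \<open>\<sigma> g\<close> times a D-th power, then dividing by
  \<open>\<sigma> f\<close> changes \<open>g\<close> but keeps the D-th power, so the equation at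
  \<open>h\<close> is the one at \<open>g\<close>. Since \<open>d\<close> divides \<open>D\<close>,
  the same \<open>g\<close> also decides whether \<open>h\<close> is in the spread of
  \<open>E\<close>.\<close>

lemma tiling_push_forward:
  assumes A: "tiling G J F E A" "\<And>j. power_closed G D (A j)" and D: "0 < D" "d dvd D"
  shows "tiling H J (\<lambda>j. \<sigma> ` F j) (spread d E) (\<lambda>j. spread D (A j))"
  unfolding tiling_H_iff
proof (intro conjI ballI)
  show "spread D (A j) \<subseteq> carrier H" for j
    using A(2)[of j] by (intro spread_subset) (auto simp: power_closed_def)
  fix h assume "h \<in> carrier H"
  then obtain g y where g: "g \<in> carrier G" and y: "y \<in> carrier H" and h: "h = \<sigma> g \<otimes>\<^bsub>H\<^esub> y [^]\<^bsub>H\<^esub> D"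
    using dense D(1) by blast
  obtain k where k: "D = k * d"
    using D(2) by (metis dvdE mult.commute)
  have "h = \<sigma> g \<otimes>\<^bsub>H\<^esub> (y [^]\<^bsub>H\<^esub> k) [^]\<^bsub>H\<^esub> d"
    using y by (simp add: h k H.nat_pow_pow)
  then have "h \<in> spread d E \<longleftrightarrow> g \<in> E"
    using mem_spread_iff[OF E g, of "y [^]\<^bsub>H\<^esub> k"] y by simp
  moreover have "card (cover H J (\<lambda>j. \<sigma> ` F j) (\<lambda>j. spread D (A j)) h) = card (cover G J F A g)"
  proof (rule card_cover_eq)
    fix j f assume j: "j \<in> {1..J}" "f \<in> F j"
    then have f: "f \<in> carrier G"
      using F by blast
    have "h \<otimes>\<^bsub>H\<^esub> inv\<^bsub>H\<^esub> \<sigma> f = \<sigma> (g \<otimes>\<^bsub>G\<^esub> inv\<^bsub>G\<^esub> f) \<otimes>\<^bsub>H\<^esub> y [^]\<^bsub>H\<^esub> D"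
      using f g y by (simp add: h H.m_ac)
    then show "h \<otimes>\<^bsub>H\<^esub> inv\<^bsub>H\<^esub> \<sigma> f \<in> spread D (A j) \<longleftrightarrow> g \<otimes>\<^bsub>G\<^esub> inv\<^bsub>G\<^esub> f \<in> A j"
      using mem_spread_iff[of D "A j" "g \<otimes>\<^bsub>G\<^esub> inv\<^bsub>G\<^esub> f" y] A(2) D(1) f g y by simp
  qed (rule inj_on_tile)
  ultimately show "card (cover H J (\<lambda>j. \<sigma> ` F j) (\<lambda>j. spread D (A j)) h) = (if h \<in> spread d E then 1 else 0)"
    using A(1) g unfolding tiling_G_iff by simp
qed

end

end

section \<open>Products of commutative groups\<close>

lemma comm_group_product_group:
  assumes "\<And>i. i \<in> I \<Longrightarrow> comm_group (A i)"
  shows "comm_group (product_group I A)"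
proof -
  interpret group "product_group I A"
    using assms by (intro product_group comm_group.axioms)
  show ?thesis
    by (rule group_comm_groupI) (auto intro!: restrict_ext comm_monoid.m_comm[OF comm_group.axioms(1)[OF assms]])
qed

lemma comm_group_DirProd:
  assumes "comm_group A" "comm_group B"
  shows "comm_group (A \<times>\<times> B)"
proof -
  interpret A: comm_group A by fact
  interpret B: comm_group B by fact
  interpret group "A \<times>\<times> B"
    by (rule DirProd_group) unfold_locales
  show ?thesis
    by (rule group_comm_groupI) (auto simp: A.m_comm B.m_comm)
qed

lemma pow_DirProd: "(a, b) [^]\<^bsub>A \<times>\<times> B\<^esub> (n :: nat) = (a [^]\<^bsub>A\<^esub> n, b [^]\<^bsub>B\<^esub> n)"
  by (induction n) simp_all

section \<open>Definability in a universe\<close>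

primrec rename_vars :: "(nat \<Rightarrow> nat) \<Rightarrow> fm \<Rightarrow> fm" where
  "rename_vars f (Mem m n) = Mem (f m) (f n)"
| "rename_vars f (Eq m n) = Eq (f m) (f n)"
| "rename_vars f (Neg p) = Neg (rename_vars f p)"
| "rename_vars f (Conj p q) = Conj (rename_vars f p) (rename_vars f q)"
| "rename_vars f (Exists n p) = Exists (f n) (rename_vars f p)"

text \<open>Bound variables count too: at and above the bound no variable occurs in the formula,
  which makes room for the renaming in \<open>definable_ex\<close>.\<close>

primrec var_bound :: "fm \<Rightarrow> nat" where
  "var_bound (Mem m n) = Suc (max m n)"
| "var_bound (Eq m n) = Suc (max m n)"
| "var_bound (Neg p) = var_bound p"
| "var_bound (Conj p q) = max (var_bound p) (var_bound q)"
| "var_bound (Exists n p) = max (Suc n) (var_bound p)"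

definition prepend :: "nat \<Rightarrow> (nat \<Rightarrow> 'a) \<Rightarrow> (nat \<Rightarrow> 'a) \<Rightarrow> nat \<Rightarrow> 'a" where
  "prepend N c e = (\<lambda>i. if i < N then c i else e (i - N))"

lemma prepend_case_nat:
  "prepend N c (case_nat x e) i = (if i < N then c i else if i = N then x else e (i - Suc N))"
proof (cases "i \<le> N")
  case False
  then have "i - N = Suc (i - Suc N)" by simp
  then show ?thesis using False by (simp add: prepend_def)
qed (auto simp: prepend_def)

lemma range_case_nat: "x \<in> U \<Longrightarrow> range e \<subseteq> U \<Longrightarrow> range (case_nat x e) \<subseteq> U"
  by (force split: nat.splits)

lemma range_Suc: "range e \<subseteq> U \<Longrightarrow> range (\<lambda>n. e (Suc n)) \<subseteq> U"
  by auto

context set_structure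
begin

text \<open>Bound variables are renamed along with the free ones; injectivity excludes
  capture.\<close>

lemma sat_rename_vars: "inj f \<Longrightarrow> sat (rename_vars f p) e = sat p (e \<circ> f)"
proof (induction p arbitrary: e)
  case (Exists n p)
  have "e(f n := x) \<circ> f = (e \<circ> f)(n := x)" for x
    using Exists.prems by (auto simp: fun_eq_iff inj_eq)
  then show ?case
    by (simp only: rename_vars.simps sat.simps Exists.IH[OF Exists.prems])
qed auto

lemma sat_cong: "(\<And>i. i < var_bound p \<Longrightarrow> e i = e' i) \<Longrightarrow> sat p e = sat p e'"
proof (induction p arbitrary: e e')
  case (Exists n p)
  have "sat p (e(n := x)) = sat p (e'(n := x))" for x
    by (rule Exists.IH) (use Exists.prems in auto)
  then show ?case by simp
next
  case (Conj p q)
  have "sat p e = sat p e'" "sat q e = sat q e'"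
    using Conj.prems by (auto intro!: Conj.IH)
  then show ?case by simp
next
  case (Neg p)
  have "sat p e = sat p e'"
    by (rule Neg.IH) (use Neg.prems in simp)
  then show ?case by simp
qed simp_all

text \<open>The variables below \<open>N\<close> carry parameters; variable \<open>N + i\<close> carries \<open>e i\<close>. Quantifiers then act on
  \<open>e\<close> as on de Bruijn indices.\<close>

definition definable :: "((nat \<Rightarrow> 'u) \<Rightarrow> bool) \<Rightarrow> bool" where
  "definable P \<longleftrightarrow> (\<exists>p c N. range c \<subseteq> U \<and>
     (\<forall>e. range e \<subseteq> U \<longrightarrow> P e = sat p (prepend N c e)))"

text \<open>Values must stay in \<open>U\<close> so that a quantified variable can stand for the
  value of a term. In the graph, variable 0 is the value and the arguments move up by one.\<close>

definition definable_term :: "((nat \<Rightarrow> 'u) \<Rightarrow> 'u) \<Rightarrow> bool" where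
  "definable_term t \<longleftrightarrow> (\<forall>e. range e \<subseteq> U \<longrightarrow> t e \<in> U) \<and>
     definable (\<lambda>e. e 0 = t (\<lambda>n. e (Suc n)))"

lemma definable_cong:
  assumes "definable P" "\<And>e. range e \<subseteq> U \<Longrightarrow> P e = Q e"
  shows "definable Q"
  using assms unfolding definable_def by metis

lemma definable_not: "definable P \<Longrightarrow> definable (\<lambda>e. \<not> P e)"
  unfolding definable_def by (metis sat.simps(3))

lemma definable_conj:
  assumes "definable P" "definable Q"
  shows "definable (\<lambda>e. P e \<and> Q e)"
proof -
  obtain p c N where p: "range c \<subseteq> U" "\<And>e. range e \<subseteq> U \<Longrightarrow> P e = sat p (prepend N c e)"
    using assms unfolding definable_def by blast
  obtain q d M where q: "range d \<subseteq> U" "\<And>e. range e \<subseteq> U \<Longrightarrow> Q e = sat q (prepend M d e)"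
    using assms unfolding definable_def by blast
  \<comment> \<open>The parameters of both formulas are put side by side, those of \<open>q\<close>
    after those of \<open>p\<close>; either renaming skips the block of the other formula.\<close>
  let ?f = "\<lambda>i. if i < N then i else i + M" and ?g = "\<lambda>i. if i < M then N + i else i + N"
  let ?c = "prepend N c d"
  have inj: "inj ?f" "inj ?g"
    by (rule injI; auto split: if_splits)+
  have "prepend (N + M) ?c e \<circ> ?f = prepend N c e" "prepend (N + M) ?c e \<circ> ?g = prepend M d e" for e
    by (auto simp: prepend_def fun_eq_iff)
  then have "P e \<and> Q e \<longleftrightarrow> sat (Conj (rename_vars ?f p) (rename_vars ?g q)) (prepend (N + M) ?c e)"
    if "range e \<subseteq> U" for e
    using that inj by (simp add: sat_rename_vars p q)
  moreover have "range ?c \<subseteq> U"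
    using p q by (auto simp: prepend_def)
  ultimately show ?thesis
    unfolding definable_def by blast
qed

lemma definable_rename:
  assumes "definable P" "inj f"
  shows "definable (\<lambda>e. P (\<lambda>i. e (f i)))"
proof -
  obtain p c N where p: "range c \<subseteq> U" "\<And>e. range e \<subseteq> U \<Longrightarrow> P e = sat p (prepend N c e)"
    using assms unfolding definable_def by blast
  let ?f = "\<lambda>i. if i < N then i else f (i - N) + N"
  have inj: "inj ?f"
  proof (rule injI)
    fix i j assume "?f i = ?f j"
    then have "i < N \<and> i = j \<or> \<not> i < N \<and> \<not> j < N \<and> f (i - N) = f (j - N)"
      by (simp split: if_splits)
    then show "i = j"
      using injD[OF \<open>inj f\<close>, of "i - N" "j - N"] by linarith
  qed
  have "prepend N c e \<circ> ?f = prepend N c (\<lambda>i. e (f i))" for e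
    by (auto simp: prepend_def fun_eq_iff)
  then have "P (\<lambda>i. e (f i)) = sat (rename_vars ?f p) (prepend N c e)" if "range e \<subseteq> U" for e
    using that inj by (subst p) (auto simp: sat_rename_vars)
  then show ?thesis
    using p unfolding definable_def by blast
qed

text \<open>\<open>Exists\<close> binds a named variable, while \<open>e 0\<close> sits directly
  after the parameters. The renaming sends that variable to position \<open>M\<close> and lowers
  those between by one. Lowering all later variables would leave no free position, so the shift
  stops at \<open>M\<close>, beyond which \<open>p\<close> has no variables.\<close>

lemma definable_ex:
  assumes "definable (\<lambda>e. Q (\<lambda>n. e (Suc n)) (e 0))"
  shows "definable (\<lambda>e. \<exists>x\<in>U. Q e x)"
proof -
  obtain p c N where p: "range c \<subseteq> U"
    "\<And>e. range e \<subseteq> U \<Longrightarrow> Q (\<lambda>n. e (Suc n)) (e 0) = sat p (prepend N c e)"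
    using assms unfolding definable_def by blast
  define M where "M = N + var_bound p"
  let ?f = "\<lambda>i. if i < N \<or> i > M then i else if i = N then M else i - 1"
  have inj: "inj ?f"
    by (rule injI) (auto split: if_splits simp: M_def)
  have "(\<exists>x\<in>U. Q e x) = sat (Exists M (rename_vars ?f p)) (prepend N c e)"
    if e: "range e \<subseteq> U" for e
  proof -
    have "Q e x = sat (rename_vars ?f p) ((prepend N c e)(M := x))" if "x \<in> U" for x
    proof -
      have "Q e x = sat p (prepend N c (case_nat x e))"
        using p(2)[of "case_nat x e"] range_case_nat[OF that e] by simp
      also have "\<dots> = sat p ((prepend N c e)(M := x) \<circ> ?f)"
        by (rule sat_cong) (simp only: prepend_case_nat, auto simp: prepend_def M_def)
      finally show ?thesis
        using inj by (simp add: sat_rename_vars)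
    qed
    then show ?thesis by simp
  qed
  then show ?thesis
    using p unfolding definable_def by blast
qed

lemma definable_disj: "definable P \<Longrightarrow> definable Q \<Longrightarrow> definable (\<lambda>e. P e \<or> Q e)"
  by (rule definable_cong[of "\<lambda>e. \<not> (\<not> P e \<and> \<not> Q e)"])
    (intro definable_not definable_conj, auto)

lemma definable_imp: "definable P \<Longrightarrow> definable Q \<Longrightarrow> definable (\<lambda>e. P e \<longrightarrow> Q e)"
  by (rule definable_cong[of "\<lambda>e. \<not> P e \<or> Q e"]) (intro definable_not definable_disj, auto)

lemma definable_iff: "definable P \<Longrightarrow> definable Q \<Longrightarrow> definable (\<lambda>e. P e \<longleftrightarrow> Q e)"
  by (rule definable_cong[of "\<lambda>e. (P e \<longrightarrow> Q e) \<and> (Q e \<longrightarrow> P e)"])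
    (intro definable_imp definable_conj, auto)

lemma definable_all:
  assumes "definable (\<lambda>e. Q (\<lambda>n. e (Suc n)) (e 0))"
  shows "definable (\<lambda>e. \<forall>x\<in>U. Q e x)"
  by (rule definable_cong[of "\<lambda>e. \<not> (\<exists>x\<in>U. \<not> Q e x)"])
    (intro definable_not definable_ex assms, auto)

end

section \<open>Definable terms, and the axiom schemas for definable properties\<close>

context zfc_universe
begin

lemma U_nonempty: "U \<noteq> {}"
  using infinity by blast

lemma definable_const_eq:
  assumes "c \<in> U" shows "definable (\<lambda>e. e i = c)"
  unfolding definable_def
  by (rule exI[of _ "Eq 0 (Suc i)"], rule exI[of _ "\<lambda>_. c"], rule exI[of _ 1])
    (use assms in \<open>auto simp: prepend_def\<close>)

lemma definable_var_eq: "definable (\<lambda>e. e i = e j)"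
proof -
  obtain c where "c \<in> U" using U_nonempty by blast
  then show ?thesis
    unfolding definable_def
    by (intro exI[of _ "Eq i j"] exI[of _ "\<lambda>_. c"] exI[of _ 0]) (auto simp: prepend_def)
qed

lemma definable_var_mem: "definable (\<lambda>e. e i \<E> e j)"
proof -
  obtain c where "c \<in> U" using U_nonempty by blast
  then show ?thesis
    unfolding definable_def
    by (intro exI[of _ "Mem i j"] exI[of _ "\<lambda>_. c"] exI[of _ 0]) (auto simp: prepend_def)
qed

lemma definable_term_in: "definable_term t \<Longrightarrow> range e \<subseteq> U \<Longrightarrow> t e \<in> U"
  by (simp add: definable_term_def)

lemma definable_term_var: "definable_term (\<lambda>e. e i)"
  using definable_var_eq[of 0 "Suc i"] by (auto simp: definable_term_def)

lemma definable_term_const: "c \<in> U \<Longrightarrow> definable_term (\<lambda>e. c)"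
  using definable_const_eq[of c 0] by (auto simp: definable_term_def)

text \<open>Substitution of terms: their values are quantified and \<open>R\<close> is applied to
  the quantified variables. The quantifiers come in reverse order, so that the first argument of
  \<open>R\<close>, being innermost, is variable 0.\<close>

lemma definable_rel3:
  assumes t: "definable_term t0" "definable_term t1" "definable_term t2"
    and R: "definable (\<lambda>e. R (e 0) (e 1) (e 2))"
  shows "definable (\<lambda>e. R (t0 e) (t1 e) (t2 e))"
proof (rule definable_cong)
  have g: "definable (\<lambda>e. e 0 = t (\<lambda>n. e (Suc (n + k))))" if "definable_term t" for t k
  proof -
    have "definable (\<lambda>e. e 0 = t (\<lambda>n. e (Suc n)))"
      using that by (simp add: definable_term_def)
    from definable_rename[OF this, of "case_nat 0 (\<lambda>n. Suc (n + k))"]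
    show ?thesis
      by (simp add: inj_on_def split: nat.splits)
  qed
  show "definable (\<lambda>e. \<exists>x\<in>U. x = t2 e \<and> (\<exists>y\<in>U. y = t1 e \<and> (\<exists>z\<in>U. z = t0 e \<and> R z y x)))"
    using g[OF t(3), of 0] g[OF t(2), of 1] g[OF t(1), of 2] R
    by (intro definable_ex definable_conj) (auto simp: numeral_2_eq_2)
  show "(\<exists>x\<in>U. x = t2 e \<and> (\<exists>y\<in>U. y = t1 e \<and> (\<exists>z\<in>U. z = t0 e \<and> R z y x))) = R (t0 e) (t1 e) (t2 e)"
    if "range e \<subseteq> U" for e
    using that t by (auto dest: definable_term_in)
qed

lemma definable_rel2:
  assumes "definable_term t0" "definable_term t1" "definable (\<lambda>e. R (e 0) (e 1))"
  shows "definable (\<lambda>e. R (t0 e) (t1 e))"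
  by (rule definable_rel3[of t0 t1 t1 "\<lambda>x y z. R x y"]) (use assms in auto)

lemma definable_eq: "definable_term s \<Longrightarrow> definable_term t \<Longrightarrow> definable (\<lambda>e. s e = t e)"
  by (rule definable_rel2[of s t "(=)"]) (assumption | rule definable_var_eq)+

lemma definable_mem: "definable_term s \<Longrightarrow> definable_term t \<Longrightarrow> definable (\<lambda>e. s e \<E> t e)"
  by (rule definable_rel2[of s t "(\<E>)"]) (assumption | rule definable_var_mem)+

lemma definable_ext: "definable_term s \<Longrightarrow> definable_term t \<Longrightarrow> definable (\<lambda>e. s e \<in> ext (t e))"
  by (rule definable_cong[of "\<lambda>e. s e \<E> t e"]) (auto simp: ext_def definable_term_in definable_mem)

lemma definable_term_weaken:
  assumes "definable_term t"
  shows "definable_term (\<lambda>e. t (\<lambda>n. e (Suc n)))"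
proof -
  have "definable (\<lambda>e. e 0 = t (\<lambda>n. e (Suc n)))"
    using assms by (simp add: definable_term_def)
  from definable_rename[OF this, of "case_nat 0 (\<lambda>n. Suc (n + 1))"]
  have "definable (\<lambda>e. e 0 = t (\<lambda>n. e (Suc (Suc n))))"
    by (simp add: inj_on_def split: nat.splits)
  then show ?thesis
    using definable_term_in[OF assms range_Suc] by (simp add: definable_term_def)
qed

lemma definable_bex:
  assumes "definable_term t" "definable (\<lambda>e. Q (\<lambda>n. e (Suc n)) (e 0))"
  shows "definable (\<lambda>e. \<exists>x\<in>ext (t e). Q e x)"
proof -
  have "definable (\<lambda>e. \<exists>x\<in>U. x \<in> ext (t e) \<and> Q e x)"
    using assms by (intro definable_ex definable_conj definable_ext definable_term_weaken definable_term_var)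
  then show ?thesis
    by (rule definable_cong) (auto simp: ext_def)
qed

lemma definable_ball:
  assumes "definable_term t" "definable (\<lambda>e. Q (\<lambda>n. e (Suc n)) (e 0))"
  shows "definable (\<lambda>e. \<forall>x\<in>ext (t e). Q e x)"
  by (rule definable_cong[of "\<lambda>e. \<not> (\<exists>x\<in>ext (t e). \<not> Q e x)"])
    (intro definable_not definable_bex assms, auto)

lemma definable_term_fun2:
  assumes "definable_term t1" "definable_term t2"
    and "\<And>x y. x \<in> U \<Longrightarrow> y \<in> U \<Longrightarrow> f x y \<in> U"
    and "definable (\<lambda>e. e 0 = f (e 1) (e 2))"
  shows "definable_term (\<lambda>e. f (t1 e) (t2 e))"
proof -
  have "definable (\<lambda>e. e 0 = f (t1 (\<lambda>n. e (Suc n))) (t2 (\<lambda>n. e (Suc n))))"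
    by (rule definable_rel3[of "\<lambda>e. e 0" "\<lambda>e. t1 (\<lambda>n. e (Suc n))" "\<lambda>e. t2 (\<lambda>n. e (Suc n))"
          "\<lambda>x y z. x = f y z"])
      (rule definable_term_var definable_term_weaken assms)+
  then show ?thesis
    using assms(1-3) by (simp add: definable_term_def)
qed

lemma definable_term_fun1:
  assumes "definable_term t"
    and "\<And>x. x \<in> U \<Longrightarrow> f x \<in> U" "definable (\<lambda>e. e 0 = f (e 1))"
  shows "definable_term (\<lambda>e. f (t e))"
  by (rule definable_term_fun2[of t t "\<lambda>x y. f x"]) (use assms in auto)

lemma separation_definable:
  assumes "a \<in> U" "definable (\<lambda>e. P (e 0))"
  shows "\<exists>y\<in>U. \<forall>x\<in>U. x \<E> y \<longleftrightarrow> x \<E> a \<and> P x"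
proof -
  obtain p c N where p: "range c \<subseteq> U" "\<And>e. range e \<subseteq> U \<Longrightarrow> P (e 0) = sat p (prepend N c e)"
    using assms unfolding definable_def by blast
  \<comment> \<open>The axiom schema wants the element in variable 0, where \<open>definable\<close>
    keeps parameters: the parameters move up by one and variable \<open>N\<close> moves to
    0.\<close>
  let ?f = "\<lambda>i. if i < N then Suc i else if i = N then 0 else i"
  let ?e = "\<lambda>i. if 0 < i \<and> i \<le> N then c (i - 1) else a"
  have inj: "inj ?f"
    by (rule injI) (auto split: if_splits)
  have "sat (rename_vars ?f p) (?e(0 := x)) = P x" if "x \<in> U" for x
  proof -
    have "?e(0 := x) \<circ> ?f = prepend N c (case_nat x (\<lambda>_. a))"
      by (auto simp: fun_eq_iff prepend_def split: nat.splits)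
    then show ?thesis
      using p(2)[OF range_case_nat[of x U "\<lambda>_. a"]] that inj assms(1)
      by (simp add: sat_rename_vars image_subset_iff del: fun_upd_apply)
  qed
  moreover have "range ?e \<subseteq> U"
    using p(1) assms(1) by auto
  ultimately show ?thesis
    using separation[of ?e a "rename_vars ?f p"] assms(1) by simp
qed

lemma replacement_definable:
  assumes "a \<in> U" "\<And>x. x \<in> U \<Longrightarrow> f x \<in> U" "definable (\<lambda>e. e 1 = f (e 0))"
  shows "\<exists>b\<in>U. \<forall>y\<in>U. y \<E> b \<longleftrightarrow> (\<exists>x\<in>U. x \<E> a \<and> y = f x)"
proof -
  obtain p c N where p: "range c \<subseteq> U" "\<And>e. range e \<subseteq> U \<Longrightarrow> (e 1 = f (e 0)) = sat p (prepend N c e)"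
    using assms(3) unfolding definable_def by blast
  \<comment> \<open>As for Separation, with two variables in front: the argument in 0 and the value
    in 1.\<close>
  let ?f = "\<lambda>i. if i < N then i + 2 else if i \<le> Suc N then i - N else i"
  let ?e = "\<lambda>i. if 1 < i \<and> i < N + 2 then c (i - 2) else a"
  have inj: "inj ?f"
    by (rule injI) (auto split: if_splits)
  have *: "sat (rename_vars ?f p) (?e(0 := x, 1 := y)) \<longleftrightarrow> y = f x" if "x \<in> U" "y \<in> U" for x y
  proof -
    have "?e(0 := x, 1 := y) \<circ> ?f = prepend N c (case_nat x (case_nat y (\<lambda>_. a)))"
      by (auto simp: fun_eq_iff prepend_def split: nat.splits)
    then show ?thesis
      using p(2)[OF range_case_nat[OF _ range_case_nat[of y U "\<lambda>_. a"]], of x] that inj assms(1)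
      by (simp add: sat_rename_vars image_subset_iff del: fun_upd_apply)
  qed
  moreover have "range ?e \<subseteq> U"
    using p(1) assms(1) by auto
  moreover have "\<exists>!y. y \<in> U \<and> sat (rename_vars ?f p) (?e(0 := x, 1 := y))" if "x \<in> U" for x
    using that * assms(2) by auto
  ultimately show ?thesis
    using replacement[of ?e a "rename_vars ?f p"] assms(1) by simp
qed

end

section \<open>Arithmetic in a universe\<close>

context zfc_universe
begin

section \<open>Extensionality, ordered pairs and successors\<close>

lemma eqI: "x \<in> U \<Longrightarrow> y \<in> U \<Longrightarrow> (\<And>z. z \<in> U \<Longrightarrow> z \<E> x \<longleftrightarrow> z \<E> y) \<Longrightarrow> x = y"
  using extensionality by blast

lemma collect_eqI: "y \<in> U \<Longrightarrow> (\<And>x. x \<in> U \<Longrightarrow> x \<E> y \<longleftrightarrow> P x) \<Longrightarrow> collect P = y"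
  unfolding collect_def by (rule the_equality) (auto intro!: eqI)

lemma collect_props:
  assumes "\<exists>y\<in>U. \<forall>x\<in>U. x \<E> y \<longleftrightarrow> P x"
  shows collect_in_U: "collect P \<in> U" and mem_collect: "x \<in> U \<Longrightarrow> x \<E> collect P \<longleftrightarrow> P x"
  using assms collect_eqI[of _ P] by blast+

text \<open>\<open>collect\<close> is a description operator and not a formula. This turns an
  equation with it into a condition quantified over \<open>U\<close>, as needed for the graphs of
  pairs and of integers.\<close>

lemma eq_collect_iff:
  assumes "y \<in> U" "\<exists>z\<in>U. \<forall>x\<in>U. x \<E> z \<longleftrightarrow> P x"
  shows "(\<forall>x\<in>U. x \<E> y \<longleftrightarrow> P x) \<longleftrightarrow> y = collect P"
proof
  assume "\<forall>x\<in>U. x \<E> y \<longleftrightarrow> P x"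
  then show "y = collect P"
    using collect_eqI[OF assms(1)] by simp
qed (use mem_collect[OF assms(2)] in simp)

lemma empty_in_U [simp]: "empty \<in> U" and not_mem_empty [simp]: "x \<in> U \<Longrightarrow> \<not> x \<E> empty"
proof -
  have "\<exists>y\<in>U. \<forall>x\<in>U. x \<E> y \<longleftrightarrow> False"
    using infinity by blast
  from collect_props[OF this] show "empty \<in> U" "x \<in> U \<Longrightarrow> \<not> x \<E> empty"
    by (auto simp: empty_def)
qed

abbreviation sing :: "'a \<Rightarrow> 'a" where
  "sing a \<equiv> collect (\<lambda>y. y = a)"

abbreviation upair :: "'a \<Rightarrow> 'a \<Rightarrow> 'a" where
  "upair a b \<equiv> collect (\<lambda>y. y = a \<or> y = b)"

lemma
  assumes "a \<in> U" "b \<in> U"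
  shows upair_in_U [simp]: "upair a b \<in> U"
    and mem_upair [simp]: "x \<in> U \<Longrightarrow> x \<E> upair a b \<longleftrightarrow> x = a \<or> x = b"
  using collect_props[OF pairing[OF assms]] by auto

lemma
  assumes "a \<in> U"
  shows sing_in_U [simp]: "sing a \<in> U" and mem_sing [simp]: "x \<in> U \<Longrightarrow> x \<E> sing a \<longleftrightarrow> x = a"
  using upair_in_U[OF assms assms] mem_upair[OF assms assms] by simp_all

lemma
  assumes "a \<in> U" "b \<in> U"
  shows pair_in_U [simp]: "pair a b \<in> U"
    and mem_pair: "x \<in> U \<Longrightarrow> x \<E> pair a b \<longleftrightarrow> x = sing a \<or> x = upair a b"
  unfolding pair_def using assms by simp_all

lemma sing_eq_upair_iff:
  assumes "a \<in> U" "b \<in> U" "c \<in> U"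
  shows "sing a = upair b c \<longleftrightarrow> a = b \<and> a = c"
proof
  assume eq: "sing a = upair b c"
  have "b \<E> sing a" "c \<E> sing a"
    unfolding eq using assms by simp_all
  then show "a = b \<and> a = c"
    using assms by simp
qed auto

lemma sing_eq_iff:
  assumes "a \<in> U" "b \<in> U"
  shows "sing a = sing b \<longleftrightarrow> a = b"
  using sing_eq_upair_iff[of a b b] assms by simp

lemma upair_eq_iff:
  assumes "a \<in> U" "b \<in> U" "d \<in> U"
  shows "upair a b = upair a d \<longleftrightarrow> b = d"
proof
  assume eq: "upair a b = upair a d"
  have "b \<E> upair a d"
    unfolding eq[symmetric] using assms by simp
  moreover have "d \<E> upair a b"
    unfolding eq using assms by simp
  ultimately show "b = d"
    using assms by auto
qed auto

lemma pair_eq_iff [simp]: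
  assumes "a \<in> U" "b \<in> U" "c \<in> U" "d \<in> U"
  shows "pair a b = pair c d \<longleftrightarrow> a = c \<and> b = d"
proof
  assume eq: "pair a b = pair c d"
  have "sing a \<E> pair c d" "upair a b \<E> pair c d"
    unfolding eq[symmetric] using assms by (simp_all add: mem_pair)
  moreover have "upair c d \<E> pair a b" "sing c \<E> pair a b"
    unfolding eq using assms by (simp_all add: mem_pair)
  ultimately have *: "sing a = sing c \<or> sing a = upair c d" "upair a b = sing c \<or> upair a b = upair c d"
    "upair c d = sing a \<or> upair c d = upair a b" "sing c = sing a \<or> sing c = upair a b"
    using assms by (simp_all add: mem_pair)
  have "a = c"
    using *(1) assms by (auto simp: sing_eq_iff sing_eq_upair_iff)
  moreover have "b = d"
    using *(2,3) assms unfolding \<open>a = c\<close>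
    by (auto simp: upair_eq_iff sing_eq_upair_iff eq_commute[of "upair _ _" "sing _"])
  ultimately show "a = c \<and> b = d" ..
qed auto

lemma union2:
  assumes "a \<in> U" "b \<in> U"
  shows "\<exists>y\<in>U. \<forall>x\<in>U. x \<E> y \<longleftrightarrow> x \<E> a \<or> x \<E> b"
proof -
  have "(\<exists>c\<in>U. c \<E> upair a b \<and> x \<E> c) \<longleftrightarrow> x \<E> a \<or> x \<E> b" for x
    using assms by auto
  then show ?thesis
    using union[OF upair_in_U[OF assms]] by simp
qed

lemma
  assumes "n \<in> U"
  shows succ_in_U [simp]: "succ n \<in> U" and mem_succ: "x \<in> U \<Longrightarrow> x \<E> succ n \<longleftrightarrow> x \<E> n \<or> x = n"
proof -
  have "\<exists>y\<in>U. \<forall>x\<in>U. x \<E> y \<longleftrightarrow> x \<E> n \<or> x = n"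
    using union2[OF assms sing_in_U[OF assms]] assms by (simp cong: ball_cong)
  from collect_props[OF this] show "succ n \<in> U" "x \<in> U \<Longrightarrow> x \<E> succ n \<longleftrightarrow> x \<E> n \<or> x = n"
    by (auto simp: succ_def)
qed

lemma succ_neq_empty [simp]: "n \<in> U \<Longrightarrow> succ n \<noteq> empty" "n \<in> U \<Longrightarrow> empty \<noteq> succ n"
  by (metis mem_succ not_mem_empty)+

text \<open>Equal successors of distinct \<open>m\<close> and \<open>n\<close> would give
  \<open>m \<E> n\<close> and \<open>n \<E> m\<close>, which Foundation excludes for
  \<open>upair m n\<close>.\<close>

lemma succ_inject [simp]:
  assumes "m \<in> U" "n \<in> U"
  shows "succ m = succ n \<longleftrightarrow> m = n"
proof (rule ccontr)
  assume "(succ m = succ n) \<noteq> (m = n)"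
  then have "m \<noteq> n" "succ m = succ n"
    by auto
  then have "m \<E> n" "n \<E> m"
    using assms by (metis mem_succ)+
  moreover have "\<exists>y\<in>U. y \<E> upair m n \<and> \<not> (\<exists>z\<in>U. z \<E> upair m n \<and> z \<E> y)"
    by (rule foundation) (use assms in auto)
  ultimately show False
    using assms by auto
qed

lemma definable_term_succ:
  assumes "definable_term t"
  shows "definable_term (\<lambda>e. succ (t e))"
proof (rule definable_term_fun1[OF assms])
  have "definable (\<lambda>e. \<forall>w\<in>U. w \<E> e 0 \<longleftrightarrow> w \<E> e 1 \<or> w = e 1)"
    by (intro definable_all definable_iff definable_disj definable_mem definable_eq definable_term_var)
  then show "definable (\<lambda>e. e 0 = succ (e 1))"
    by (rule definable_cong) (auto simp: mem_succ image_subset_iff intro!: eqI)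
qed auto

lemma definable_term_pair:
  assumes "definable_term s" "definable_term t"
  shows "definable_term (\<lambda>e. pair (s e) (t e))"
proof (rule definable_term_fun2[OF assms])
  have "definable (\<lambda>e. \<forall>x\<in>U. x \<E> e 0 \<longleftrightarrow> (\<forall>w\<in>U. w \<E> x \<longleftrightarrow> w = e 1) \<or> (\<forall>w\<in>U. w \<E> x \<longleftrightarrow> w = e 1 \<or> w = e 2))"
    by (intro definable_all definable_iff definable_disj definable_mem definable_eq definable_term_var)
  moreover have "(\<forall>x\<in>U. x \<E> y \<longleftrightarrow> (\<forall>w\<in>U. w \<E> x \<longleftrightarrow> w = a) \<or> (\<forall>w\<in>U. w \<E> x \<longleftrightarrow> w = a \<or> w = b)) \<longleftrightarrow>
      y = pair a b" if "y \<in> U" "a \<in> U" "b \<in> U" for y a b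
  proof -
    have "(\<forall>w\<in>U. w \<E> x \<longleftrightarrow> w = a) \<longleftrightarrow> x = sing a" "(\<forall>w\<in>U. w \<E> x \<longleftrightarrow> w = a \<or> w = b) \<longleftrightarrow> x = upair a b"
      if "x \<in> U" for x
      using eq_collect_iff[OF that pairing, of a b] eq_collect_iff[OF that pairing, of a a]
        \<open>a \<in> U\<close> \<open>b \<in> U\<close> by simp_all
    moreover have "(\<forall>x\<in>U. x \<E> y \<longleftrightarrow> x = sing a \<or> x = upair a b) \<longleftrightarrow> y = pair a b"
      unfolding pair_def by (rule eq_collect_iff) (use that pairing in auto)
    ultimately show ?thesis
      by simp
  qed
  ultimately show "definable (\<lambda>e. e 0 = pair (e 1) (e 2))"
    by (rule definable_cong) (auto simp: image_subset_iff)
qed auto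

lemmas definable_intros = definable_not definable_conj definable_disj definable_imp definable_iff
  definable_ex definable_all definable_bex definable_ball definable_eq definable_mem definable_ext
  definable_term_var definable_term_const definable_term_succ definable_term_pair

section \<open>The set \<open>omega\<close> and induction over it\<close>

lemma
  shows omega_in_U [simp]: "omega \<in> U"
    and mem_omega: "n \<in> U \<Longrightarrow> n \<E> omega \<longleftrightarrow>
          (\<forall>I\<in>U. empty \<E> I \<and> (\<forall>x\<in>ext I. succ x \<E> I) \<longrightarrow> n \<E> I)"
proof -
  let ?P = "\<lambda>n. \<forall>I\<in>U. empty \<E> I \<and> (\<forall>x\<in>ext I. succ x \<E> I) \<longrightarrow> n \<E> I"
  obtain I where I: "I \<in> U" and zero: "\<exists>z\<in>U. z \<E> I \<and> (\<forall>w\<in>U. \<not> w \<E> z)"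
    and step: "\<And>x. x \<in> U \<Longrightarrow> x \<E> I \<Longrightarrow> \<exists>y\<in>U. y \<E> I \<and> (\<forall>w\<in>U. w \<E> y \<longleftrightarrow> w \<E> x \<or> w = x)"
    using infinity by blast
  have "empty \<E> I"
    using zero by (metis eqI empty_in_U not_mem_empty)
  moreover have "succ x \<E> I" if x: "x \<in> ext I" for x
  proof -
    obtain y where y: "y \<in> U" "y \<E> I" "\<forall>w\<in>U. w \<E> y \<longleftrightarrow> w \<E> x \<or> w = x"
      using step x unfolding ext_def by blast
    have "succ x = y"
      unfolding succ_def by (rule collect_eqI) (use y in auto)
    then show ?thesis using y by simp
  qed
  ultimately have *: "?P n \<Longrightarrow> n \<E> I" for n
    using I by blast
  \<comment> \<open>Since \<open>I\<close> is itself inductive, the intersection of all inductive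
    sets can be cut out of \<open>I\<close> by Separation, the property being definable.\<close>
  have "\<exists>y\<in>U. \<forall>x\<in>U. x \<E> y \<longleftrightarrow> x \<E> I \<and> ?P x"
    by (rule separation_definable[OF I]) (intro definable_intros empty_in_U)
  then have "\<exists>y\<in>U. \<forall>x\<in>U. x \<E> y \<longleftrightarrow> ?P x"
    using * by metis
  from collect_props[OF this] show "omega \<in> U" "n \<in> U \<Longrightarrow> n \<E> omega \<longleftrightarrow> ?P n"
    by (auto simp: omega_def)
qed

lemma omega_subset: "n \<in> ext omega \<Longrightarrow> n \<in> U"
  by (simp add: ext_def)

lemma empty_in_omega [simp]: "empty \<in> ext omega"
  by (auto simp: ext_def mem_omega)

lemma succ_in_omega [simp]: "n \<in> ext omega \<Longrightarrow> succ n \<in> ext omega"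
  by (auto simp: ext_def mem_omega)

text \<open>The elements of \<open>omega\<close> with \<open>P\<close> form an inductive element of
  the universe, which therefore exhausts \<open>omega\<close>. Definability is essential: being a
  standard numeral is preserved by \<open>succ\<close> but may fail in \<open>omega\<close>.\<close>

lemma omega_induct [consumes 1, case_names definable empty succ]:
  assumes n: "n \<in> ext omega" and P: "definable (\<lambda>e. P (e 0))"
    and "P empty" "\<And>n. n \<in> ext omega \<Longrightarrow> P n \<Longrightarrow> P (succ n)"
  shows "P n"
proof -
  obtain y where y: "y \<in> U" "\<And>x. x \<in> U \<Longrightarrow> x \<E> y \<longleftrightarrow> x \<E> omega \<and> P x"
    using separation_definable[OF omega_in_U P] by auto
  have "empty \<E> y"
    using assms(3) empty_in_omega by (simp add: y ext_def)
  moreover have "succ x \<E> y" if "x \<in> ext y" for x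
  proof -
    have "x \<in> ext omega" "P x"
      using that y by (auto simp: ext_def)
    then have "succ x \<in> ext omega" "P (succ x)"
      using assms(4) by auto
    then show ?thesis using y(2) by (auto simp: ext_def)
  qed
  ultimately have "n \<E> y"
    using n y(1) by (auto simp: ext_def mem_omega)
  then show ?thesis
    using n y(2) by (auto simp: ext_def)
qed

lemma omega_cases:
  assumes "n \<in> ext omega"
  shows "n = empty \<or> (\<exists>m\<in>ext omega. n = succ m)"
  using assms
proof (induction rule: omega_induct)
  case definable
  show ?case by (intro definable_intros empty_in_U omega_in_U)
qed auto

section \<open>Addition of natural numbers\<close>

lemma power_set':
  assumes "a \<in> U"
  obtains p where "p \<in> U" "\<And>x. x \<in> U \<Longrightarrow> x \<E> p \<longleftrightarrow> (\<forall>z\<in>U. z \<E> x \<longrightarrow> z \<E> a)"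
  using power_set[OF assms] by blast

text \<open>A Kuratowski pair of elements of \<open>omega\<close> is a set of subsets of
  \<open>omega\<close>. The bound is crude, but it lets Separation produce functions on
  \<open>omega\<close> and integers.\<close>

lemma pairs_of_omega_bounded:
  obtains Q where "Q \<in> U" "\<And>i j. i \<in> ext omega \<Longrightarrow> j \<in> ext omega \<Longrightarrow> pair i j \<E> Q"
proof -
  obtain p where p: "p \<in> U" "\<And>x. x \<in> U \<Longrightarrow> x \<E> p \<longleftrightarrow> (\<forall>z\<in>U. z \<E> x \<longrightarrow> z \<E> omega)"
    using power_set'[OF omega_in_U] by blast
  obtain q where q: "q \<in> U" "\<And>x. x \<in> U \<Longrightarrow> x \<E> q \<longleftrightarrow> (\<forall>z\<in>U. z \<E> x \<longrightarrow> z \<E> p)"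
    using power_set'[OF p(1)] by blast
  have "pair i j \<E> q" if "i \<in> ext omega" "j \<in> ext omega" for i j
    using that by (auto simp: ext_def q p mem_pair)
  then show thesis
    using that q by blast
qed

text \<open>The conditions on \<open>h\<close> in \<open>nadd\<close>, with unique existence
  unfolded so that the closure rules for \<open>definable\<close> apply.\<close>

definition is_add :: "'a \<Rightarrow> 'a \<Rightarrow> bool" where
  "is_add m h \<longleftrightarrow>
     (\<forall>i\<in>ext omega. \<exists>j\<in>U. pair i j \<E> h \<and> (\<forall>k\<in>U. pair i k \<E> h \<longrightarrow> k = j)) \<and>
     pair empty m \<E> h \<and>
     (\<forall>i\<in>ext omega. \<forall>j\<in>U. pair i j \<E> h \<longrightarrow> pair (succ i) (succ j) \<E> h)"

lemma nadd_is_add: "nadd m n = (THE k. k \<in> U \<and> (\<exists>h\<in>U. is_add m h \<and> pair n k \<E> h))"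
proof -
  have "(\<exists>!j. j \<in> U \<and> pair i j \<E> h) \<longleftrightarrow>
      (\<exists>j\<in>U. pair i j \<E> h \<and> (\<forall>k\<in>U. pair i k \<E> h \<longrightarrow> k = j))" for i h
    by blast
  then show ?thesis
    by (simp add: nadd_def is_add_def conj_assoc)
qed

lemma is_add_total: "is_add m h \<Longrightarrow> i \<in> ext omega \<Longrightarrow> \<exists>j\<in>U. pair i j \<E> h"
  unfolding is_add_def by blast

lemma is_add_functional:
  assumes "is_add m h" "i \<in> ext omega" "j \<in> U" "k \<in> U" "pair i j \<E> h" "pair i k \<E> h"
  shows "j = k"
proof -
  obtain l where "\<forall>k\<in>U. pair i k \<E> h \<longrightarrow> k = l"
    using assms(1,2) unfolding is_add_def by blast
  then show ?thesis
    using assms(3-6) by blast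
qed

lemma is_add_empty: "is_add m h \<Longrightarrow> pair empty m \<E> h"
  unfolding is_add_def by blast

lemma is_add_succ:
  "is_add m h \<Longrightarrow> i \<in> ext omega \<Longrightarrow> j \<in> U \<Longrightarrow> pair i j \<E> h \<Longrightarrow> pair (succ i) (succ j) \<E> h"
  unfolding is_add_def by blast

text \<open>The functions \<open>h\<close> and \<open>h'\<close> enter the formula as parameters, so
  this is a definable property of \<open>n\<close>; both obey the same recursion.\<close>

lemma is_add_unique:
  assumes "is_add m h" "is_add m h'" "h \<in> U" "h' \<in> U" "m \<in> U" "n \<in> ext omega"
  shows "\<forall>k\<in>U. \<forall>k'\<in>U. pair n k \<E> h \<and> pair n k' \<E> h' \<longrightarrow> k = k'"
  using \<open>n \<in> ext omega\<close>
proof (induction rule: omega_induct)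
  case definable
  show ?case using assms by (intro definable_intros)
next
  case empty
  show ?case
    using is_add_functional[OF assms(1) empty_in_omega assms(5) _ is_add_empty[OF assms(1)]]
      is_add_functional[OF assms(2) empty_in_omega assms(5) _ is_add_empty[OF assms(2)]]
    by blast
next
  case (succ n)
  obtain j where j: "j \<in> U" "pair n j \<E> h"
    using is_add_total[OF assms(1) succ(1)] by blast
  obtain j' where j': "j' \<in> U" "pair n j' \<E> h'"
    using is_add_total[OF assms(2) succ(1)] by blast
  have "j = j'"
    using succ(2) j j' by simp
  then show ?case
    using is_add_functional[OF assms(1) succ_in_omega[OF succ(1)] succ_in_U[OF j(1)] _
        is_add_succ[OF assms(1) succ(1) j]]
      is_add_functional[OF assms(2) succ_in_omega[OF succ(1)] succ_in_U[OF j'(1)] _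
        is_add_succ[OF assms(2) succ(1) j']]
    by blast
qed

text \<open>Induction on \<open>m\<close> takes the place of a recursion theorem: the identity
  serves for 0, and the function for \<open>m\<close> followed by \<open>succ\<close> serves for
  \<open>succ m\<close>. That values stay in \<open>omega\<close> is carried along so that the new
  graph lies within the bound \<open>Q\<close>.\<close>

lemma is_add_ex:
  assumes "m \<in> ext omega"
  shows "\<exists>h\<in>U. is_add m h \<and> (\<forall>i\<in>ext omega. \<forall>j\<in>U. pair i j \<E> h \<longrightarrow> j \<in> ext omega)"
  using assms
proof (induction rule: omega_induct)
  case definable
  show ?case unfolding is_add_def by (intro definable_intros omega_in_U empty_in_U)
next
  case empty
  obtain Q where Q: "Q \<in> U" "\<And>i j. i \<in> ext omega \<Longrightarrow> j \<in> ext omega \<Longrightarrow> pair i j \<E> Q"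
    using pairs_of_omega_bounded by blast
  have "\<exists>h\<in>U. \<forall>p\<in>U. p \<E> h \<longleftrightarrow> p \<E> Q \<and> (\<exists>i\<in>ext omega. p = pair i i)"
    by (rule separation_definable[OF Q(1)]) (intro definable_intros omega_in_U)
  then obtain h where h: "h \<in> U" "\<And>p. p \<in> U \<Longrightarrow> p \<E> h \<longleftrightarrow> p \<E> Q \<and> (\<exists>i\<in>ext omega. p = pair i i)"
    by blast
  have "pair i j \<E> h \<longleftrightarrow> i = j" if "i \<in> ext omega" "j \<in> U" for i j
    using that Q(2) by (auto simp: h omega_subset)
  then show ?case
    using h(1) by (intro bexI[of _ h]) (auto simp: is_add_def omega_subset)
next
  case (succ m)
  then obtain h where h: "h \<in> U" "is_add m h" "\<forall>i\<in>ext omega. \<forall>j\<in>U. pair i j \<E> h \<longrightarrow> j \<in> ext omega"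
    by blast
  obtain Q where Q: "Q \<in> U" "\<And>i j. i \<in> ext omega \<Longrightarrow> j \<in> ext omega \<Longrightarrow> pair i j \<E> Q"
    using pairs_of_omega_bounded by blast
  have "\<exists>h'\<in>U. \<forall>p\<in>U. p \<E> h' \<longleftrightarrow> p \<E> Q \<and>
      (\<exists>i\<in>ext omega. \<exists>j\<in>ext omega. pair i j \<E> h \<and> p = pair i (succ j))"
    by (rule separation_definable[OF Q(1)]) (intro definable_intros omega_in_U h(1))
  then obtain h' where h': "h' \<in> U" "\<And>p. p \<in> U \<Longrightarrow> p \<E> h' \<longleftrightarrow> p \<E> Q \<and>
      (\<exists>i\<in>ext omega. \<exists>j\<in>ext omega. pair i j \<E> h \<and> p = pair i (succ j))"
    by blast
  have h'_iff: "pair i k \<E> h' \<longleftrightarrow> (\<exists>j\<in>ext omega. pair i j \<E> h \<and> k = succ j)"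
    if "i \<in> ext omega" "k \<in> U" for i k
    using that Q(2) by (auto simp: h' omega_subset)
  have "is_add (succ m) h'"
    unfolding is_add_def
  proof (intro conjI ballI impI)
    fix i assume i: "i \<in> ext omega"
    then obtain j where j: "j \<in> U" "pair i j \<E> h" "\<forall>k\<in>U. pair i k \<E> h \<longrightarrow> k = j"
      using h(2) unfolding is_add_def by meson
    have "j \<in> ext omega"
      using h(3) i j(1,2) by blast
    have "pair i k \<E> h' \<longleftrightarrow> k = succ j" if "k \<in> U" for k
    proof -
      have "pair i k \<E> h' \<longleftrightarrow> (\<exists>l\<in>ext omega. pair i l \<E> h \<and> k = succ l)"
        by (rule h'_iff[OF i that])
      also have "\<dots> \<longleftrightarrow> k = succ j"
        using j(2,3) \<open>j \<in> ext omega\<close> omega_subset by blast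
      finally show ?thesis .
    qed
    then show "\<exists>j\<in>U. pair i j \<E> h' \<and> (\<forall>k\<in>U. pair i k \<E> h' \<longrightarrow> k = j)"
      using j(1) by (intro bexI[of _ "succ j"]) simp_all
  next
    show "pair empty (succ m) \<E> h'"
      using is_add_empty[OF h(2)] succ(1) by (auto simp: h'_iff omega_subset)
  next
    fix i k assume ik: "i \<in> ext omega" "k \<in> U" "pair i k \<E> h'"
    then obtain j where j: "j \<in> ext omega" "pair i j \<E> h" "k = succ j"
      by (auto simp: h'_iff)
    then have "pair (succ i) (succ j) \<E> h"
      using is_add_succ[OF h(2) ik(1)] by (simp add: omega_subset)
    then show "pair (succ i) (succ k) \<E> h'"
      using ik j by (auto simp: h'_iff omega_subset)
  qed
  then show ?case
    using h' by (intro bexI[of _ h']) (auto simp: h'_iff)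
qed

lemma nadd_eqI:
  assumes "m \<in> ext omega" "n \<in> ext omega" "h \<in> U" "is_add m h" "k \<in> U" "pair n k \<E> h"
  shows "nadd m n = k"
  unfolding nadd_is_add
  by (rule the_equality) (use assms is_add_unique[OF _ assms(4)] in \<open>blast dest: omega_subset\<close>)+

text \<open>Outside \<open>omega\<close> the description in \<open>nadd\<close> may be improper, so \<open>nadd\<close> need not be definable there;
  this totalized version is a definable term.\<close>

definition nplus :: "'a \<Rightarrow> 'a \<Rightarrow> 'a" (infixl \<open>\<boxplus>\<close> 65) where
  "m \<boxplus> n = (if m \<in> ext omega \<and> n \<in> ext omega then nadd m n else empty)"

lemma nadd_eq_nplus: "m \<in> ext omega \<Longrightarrow> n \<in> ext omega \<Longrightarrow> nadd m n = m \<boxplus> n"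
  by (simp add: nplus_def)

text \<open>The formula behind \<open>definable_term_nplus\<close>: the recursive function exists
  and its values are unique, so the description in \<open>nadd\<close> can be replaced by an
  existential quantifier.\<close>

lemma nplus_graph:
  assumes "m \<in> ext omega" "n \<in> ext omega" "k \<in> U"
  shows "k = m \<boxplus> n \<longleftrightarrow> (\<exists>h\<in>U. is_add m h \<and> pair n k \<E> h)"
proof
  assume "k = m \<boxplus> n"
  moreover obtain h where "h \<in> U" "is_add m h"
    using is_add_ex[OF assms(1)] by blast
  moreover obtain j where "j \<in> U" "pair n j \<E> h"
    using is_add_total[OF \<open>is_add m h\<close> assms(2)] by blast
  moreover have "nadd m n = j"
    by (rule nadd_eqI) fact+
  ultimately show "\<exists>h\<in>U. is_add m h \<and> pair n k \<E> h"
    using assms by (auto simp: nplus_def)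
qed (use assms nadd_eqI in \<open>auto simp: nplus_def\<close>)

lemma nplus_closed [simp]:
  assumes "m \<in> ext omega" "n \<in> ext omega"
  shows "m \<boxplus> n \<in> ext omega"
proof -
  obtain h where h: "h \<in> U" "is_add m h" "\<forall>i\<in>ext omega. \<forall>j\<in>U. pair i j \<E> h \<longrightarrow> j \<in> ext omega"
    using is_add_ex[OF assms(1)] by blast
  then obtain j where "j \<in> U" "pair n j \<E> h"
    using is_add_total assms(2) by blast
  with h nadd_eqI[OF assms] show ?thesis
    using assms by (auto simp: nplus_def)
qed

lemma nplus_empty [simp]:
  assumes "m \<in> ext omega"
  shows "m \<boxplus> empty = m"
proof -
  have "\<exists>h\<in>U. is_add m h \<and> pair empty m \<E> h"
    using is_add_ex[OF assms] is_add_empty by blast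
  then show ?thesis
    using nplus_graph[OF assms empty_in_omega] assms omega_subset by metis
qed

lemma nplus_succ [simp]:
  assumes "m \<in> ext omega" "n \<in> ext omega"
  shows "m \<boxplus> succ n = succ (m \<boxplus> n)"
proof -
  have U: "m \<boxplus> n \<in> U"
    using assms omega_subset nplus_closed by blast
  obtain h where h: "h \<in> U" "is_add m h" "pair n (m \<boxplus> n) \<E> h"
    using nplus_graph[OF assms U] by blast
  then have "pair (succ n) (succ (m \<boxplus> n)) \<E> h"
    using assms U is_add_succ by blast
  then show ?thesis
    using h nplus_graph[OF assms(1) succ_in_omega[OF assms(2)] succ_in_U[OF U]] by metis
qed

lemma definable_term_nplus:
  assumes "definable_term s" "definable_term t"
  shows "definable_term (\<lambda>e. s e \<boxplus> t e)"
proof (rule definable_term_fun2[OF assms])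
  show "x \<boxplus> y \<in> U" for x y
    using nplus_closed[of x y] omega_subset by (auto simp: nplus_def)
  have "definable (\<lambda>e. (e 1 \<in> ext omega \<and> e 2 \<in> ext omega \<and> (\<exists>h\<in>U. is_add (e 1) h \<and> pair (e 2) (e 0) \<E> h)) \<or>
      \<not> (e 1 \<in> ext omega \<and> e 2 \<in> ext omega) \<and> e 0 = empty)"
    unfolding is_add_def by (intro definable_intros omega_in_U empty_in_U)
  then show "definable (\<lambda>e. e 0 = e 1 \<boxplus> e 2)"
  proof (rule definable_cong)
    fix e :: "nat \<Rightarrow> 'a" assume e: "range e \<subseteq> U"
    then have "e 0 \<in> U" by auto
    then show "(e 1 \<in> ext omega \<and> e 2 \<in> ext omega \<and> (\<exists>h\<in>U. is_add (e 1) h \<and> pair (e 2) (e 0) \<E> h)) \<or>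
      \<not> (e 1 \<in> ext omega \<and> e 2 \<in> ext omega) \<and> e 0 = empty \<longleftrightarrow> e 0 = e 1 \<boxplus> e 2"
      using nplus_graph[of "e 1" "e 2" "e 0"] by (auto simp: nplus_def)
  qed
qed

lemmas definable_omega_intros = definable_intros definable_term_nplus omega_in_U empty_in_U omega_subset

lemma empty_nplus [simp]: "n \<in> ext omega \<Longrightarrow> empty \<boxplus> n = n"
proof (induction rule: omega_induct)
  case definable
  show ?case by (intro definable_omega_intros)
qed auto

lemma succ_nplus [simp]:
  assumes "m \<in> ext omega" "n \<in> ext omega"
  shows "succ m \<boxplus> n = succ (m \<boxplus> n)"
  using assms(2)
proof (induction rule: omega_induct)
  case definable
  show ?case using assms(1) by (intro definable_omega_intros)
qed (use assms(1) in auto)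

lemma nplus_comm:
  assumes "m \<in> ext omega" "n \<in> ext omega"
  shows "m \<boxplus> n = n \<boxplus> m"
  using assms(2)
proof (induction rule: omega_induct)
  case definable
  show ?case using assms(1) by (intro definable_omega_intros)
qed (use assms(1) in auto)

lemma nplus_assoc:
  assumes "a \<in> ext omega" "b \<in> ext omega" "c \<in> ext omega"
  shows "(a \<boxplus> b) \<boxplus> c = a \<boxplus> (b \<boxplus> c)"
  using assms(3)
proof (induction rule: omega_induct)
  case definable
  show ?case using assms(1,2) by (intro definable_omega_intros)
qed (use assms(1,2) in auto)

lemma nplus_left_comm:
  "a \<in> ext omega \<Longrightarrow> b \<in> ext omega \<Longrightarrow> c \<in> ext omega \<Longrightarrow> a \<boxplus> (b \<boxplus> c) = b \<boxplus> (a \<boxplus> c)"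
  by (metis nplus_assoc nplus_comm)

lemmas nplus_ac = nplus_assoc nplus_comm nplus_left_comm

lemma nplus_cancel:
  assumes "a \<in> ext omega" "b \<in> ext omega" "c \<in> ext omega"
  shows "a \<boxplus> c = b \<boxplus> c \<longleftrightarrow> a = b"
  using assms(3)
proof (induction rule: omega_induct)
  case definable
  show ?case using assms(1,2) by (intro definable_omega_intros)
qed (use assms(1,2) in \<open>auto simp: omega_subset\<close>)

lemma nplus_eq_empty:
  assumes "a \<in> ext omega" "b \<in> ext omega" "a \<boxplus> b = empty"
  shows "a = empty"
proof (rule ccontr)
  assume "a \<noteq> empty"
  then obtain c where "c \<in> ext omega" "a = succ c"
    using omega_cases[OF assms(1)] by blast
  then show False
    using assms(2,3) by (auto simp: omega_subset)
qed

lemma omega_linear: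
  assumes "a \<in> ext omega" "b \<in> ext omega"
  shows "\<exists>c\<in>ext omega. a = b \<boxplus> c \<or> b = a \<boxplus> c"
  using assms(1)
proof (induction rule: omega_induct)
  case definable
  show ?case using assms(2) by (intro definable_omega_intros)
next
  case (succ a)
  then obtain c where c: "c \<in> ext omega" "a = b \<boxplus> c \<or> b = a \<boxplus> c"
    by blast
  consider "a = b \<boxplus> c" | "b = a" | d where "d \<in> ext omega" "b = a \<boxplus> succ d"
    using c omega_cases[OF c(1)] succ(1) by auto
  then show ?case
  proof cases
    case 1
    then show ?thesis
      using c assms(2) by (intro bexI[of _ "succ c"]) auto
  next
    case 2
    then show ?thesis
      using assms(2) by (intro bexI[of _ "succ empty"]) auto
  next
    case 3
    then show ?thesis
      using succ(1) by (intro bexI[of _ d]) auto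
  qed
qed (use assms(2) in auto)

section \<open>Standard numerals and multiples by a standard factor\<close>

lemma num_in_omega [simp]: "num n \<in> ext omega"
  by (induction n) auto

lemma num_add: "num (m + n) = num m \<boxplus> num n"
  by (induction n) auto

lemma num_inject [simp]: "num m = num n \<longleftrightarrow> m = n"
proof (induction m arbitrary: n)
  case 0
  show ?case by (cases n) (auto simp: omega_subset)
next
  case (Suc m)
  then show ?case by (cases n) (auto simp: omega_subset)
qed

text \<open>Below a standard numeral there are only standard ones, even if \<open>omega\<close> has
  further elements. Hence residues modulo a standard number, and remainders of division by it, are
  standard.\<close>

lemma ext_num: "ext (num n) = num ` {..<n}"
proof (induction n)
  case (Suc n)
  have "ext (num (Suc n)) = insert (num n) (ext (num n))"
    using omega_subset[OF num_in_omega[of n]] by (auto simp: ext_def mem_succ)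
  then show ?case
    by (simp add: Suc lessThan_Suc)
qed (auto simp: ext_def)

text \<open>The factor is a number outside the universe, so for each \<open>d\<close> this is an
  iterated sum and a definable term; no multiplication inside the universe is introduced.\<close>

primrec nmul :: "nat \<Rightarrow> 'a \<Rightarrow> 'a" where
  "nmul 0 q = empty"
| "nmul (Suc d) q = nmul d q \<boxplus> q"

lemma nmul_closed [simp]: "q \<in> ext omega \<Longrightarrow> nmul d q \<in> ext omega"
  by (induction d) auto

lemma nmul_empty [simp]: "nmul d empty = empty"
  by (induction d) auto

lemma nmul_nplus:
  "a \<in> ext omega \<Longrightarrow> b \<in> ext omega \<Longrightarrow> nmul d (a \<boxplus> b) = nmul d a \<boxplus> nmul d b"
  by (induction d) (simp_all add: nplus_ac)

lemma nmul_succ: "q \<in> ext omega \<Longrightarrow> nmul d (succ q) = num d \<boxplus> nmul d q"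
  by (induction d) (simp_all add: nplus_assoc)

lemma definable_term_nmul: "definable_term t \<Longrightarrow> definable_term (\<lambda>e. nmul d (t e))"
  by (induction d) (simp_all add: definable_term_const definable_term_nplus)

text \<open>Induction inside the universe; the statement is definable because the remainder ranges
  over the elements of a single numeral. A remainder that reaches \<open>d\<close> is reset to 0 and
  carried into the quotient.\<close>

lemma omega_division:
  assumes "n \<in> ext omega" "0 < d"
  shows "\<exists>q\<in>ext omega. \<exists>r\<in>ext (num d). n = r \<boxplus> nmul d q"
  using assms(1)
proof (induction rule: omega_induct)
  case definable
  show ?case by (intro definable_omega_intros definable_term_nmul num_in_omega)
next
  case empty
  show ?case
    using assms(2) by (intro bexI[of _ empty]) (auto simp: ext_num intro!: image_eqI[of _ _ 0])
next
  case (succ n)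
  then obtain q k where q: "q \<in> ext omega" "k < d" "n = num k \<boxplus> nmul d q"
    by (auto simp: ext_num)
  show ?case
  proof (cases "Suc k < d")
    case True
    show ?thesis
      by (rule bexI[of _ q], rule bexI[of _ "succ (num k)"])
        (use q True in \<open>auto simp: ext_num intro!: image_eqI[of _ _ "Suc k"]\<close>)
  next
    case False
    then have d: "d = Suc k"
      using q(2) by simp
    show ?thesis
      by (rule bexI[of _ "succ q"], rule bexI[of _ empty])
        (use q d ext_num[of "Suc k"] in \<open>auto simp: nmul_succ intro!: image_eqI[of _ _ 0] simp del: nmul.simps\<close>)
  qed
qed

text \<open>The source of purity. As \<open>q\<close> is not known to be standard, the induction is
  over the standard number \<open>k\<close> and takes place outside: passing to the predecessor of
  \<open>q\<close> subtracts \<open>d\<close> from \<open>k\<close>.\<close>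

lemma nmul_eq_num:
  assumes "q \<in> ext omega" "nmul d q = num k" "0 < d"
  shows "d dvd k"
  using assms(1,2)
proof (induction k arbitrary: q rule: less_induct)
  case (less k)
  show ?case
  proof (cases "q = empty")
    case True
    then have "num k = num 0"
      using less.prems(2) by simp
    then show ?thesis
      by (simp del: num.simps)
  next
    case False
    then obtain p where p: "p \<in> ext omega" "q = succ p"
      using omega_cases[OF less.prems(1)] by blast
    then have eq: "num d \<boxplus> nmul d p = num k"
      using less.prems(2) by (simp add: nmul_succ)
    have "d \<le> k"
    proof (rule ccontr)
      assume "\<not> d \<le> k"
      \<comment> \<open>Cancelling \<open>num k\<close> would leave a sum with a positive numeral
        equal to \<open>empty\<close>.\<close>
      then have "num d = num k \<boxplus> num (d - k)"
        by (simp flip: num_add)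
      with eq have "(num (d - k) \<boxplus> nmul d p) \<boxplus> num k = empty \<boxplus> num k"
        using p by (simp add: nplus_ac)
      then have "num (d - k) \<boxplus> nmul d p = empty"
        using p by (simp only: nplus_cancel nplus_closed nmul_closed num_in_omega empty_in_omega)
      then have "num (d - k) = num 0"
        using nplus_eq_empty[of "num (d - k)" "nmul d p"] p by simp
      then show False
        using \<open>\<not> d \<le> k\<close> by (simp del: num.simps)
    qed
    then have "num k = num (k - d) \<boxplus> num d"
      by (simp flip: num_add)
    with eq have "nmul d p \<boxplus> num d = num (k - d) \<boxplus> num d"
      using p by (simp add: nplus_comm)
    then have "nmul d p = num (k - d)"
      using p by (simp only: nplus_cancel nmul_closed num_in_omega)
    then have "d dvd k - d"
      using less.IH[of "k - d" p] p \<open>d \<le> k\<close> assms(3) by simp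
    then show ?thesis
      using \<open>d \<le> k\<close> by (simp add: dvd_diff_nat dvd_minus_self)
  qed
qed

section \<open>The group of integers of a universe\<close>

lemma zdiff_nplus:
  assumes "a \<in> ext omega" "b \<in> ext omega"
  shows "zdiff a b = collect (\<lambda>p. \<exists>c\<in>ext omega. \<exists>d\<in>ext omega. p = pair c d \<and> a \<boxplus> d = c \<boxplus> b)"
  using assms by (simp add: zdiff_def nadd_eq_nplus cong: bex_cong)

lemma zdiff_ex:
  assumes "a \<in> ext omega" "b \<in> ext omega"
  shows "\<exists>z\<in>U. \<forall>p\<in>U. p \<E> z \<longleftrightarrow> (\<exists>c\<in>ext omega. \<exists>d\<in>ext omega. p = pair c d \<and> a \<boxplus> d = c \<boxplus> b)"
proof -
  obtain Q where Q: "Q \<in> U" "\<And>i j. i \<in> ext omega \<Longrightarrow> j \<in> ext omega \<Longrightarrow> pair i j \<E> Q"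
    using pairs_of_omega_bounded by blast
  have "\<exists>z\<in>U. \<forall>p\<in>U. p \<E> z \<longleftrightarrow>
      p \<E> Q \<and> (\<exists>c\<in>ext omega. \<exists>d\<in>ext omega. p = pair c d \<and> a \<boxplus> d = c \<boxplus> b)"
    using assms by (intro separation_definable[OF Q(1)] definable_omega_intros)
  moreover have "p \<E> Q \<and> (\<exists>c\<in>ext omega. \<exists>d\<in>ext omega. p = pair c d \<and> a \<boxplus> d = c \<boxplus> b) \<longleftrightarrow>
      (\<exists>c\<in>ext omega. \<exists>d\<in>ext omega. p = pair c d \<and> a \<boxplus> d = c \<boxplus> b)" for p
    using Q(2) by blast
  ultimately show ?thesis
    by simp
qed

lemma
  assumes "a \<in> ext omega" "b \<in> ext omega"
  shows zdiff_in_U [simp]: "zdiff a b \<in> U"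
    and mem_zdiff: "p \<in> U \<Longrightarrow> p \<E> zdiff a b \<longleftrightarrow>
      (\<exists>c\<in>ext omega. \<exists>d\<in>ext omega. p = pair c d \<and> a \<boxplus> d = c \<boxplus> b)"
  unfolding zdiff_nplus[OF assms] using collect_props[OF zdiff_ex[OF assms]] by blast+

lemma eq_zdiff_iff:
  assumes "a \<in> ext omega" "b \<in> ext omega" "z \<in> U"
  shows "z = zdiff a b \<longleftrightarrow>
    (\<forall>p\<in>U. p \<E> z \<longleftrightarrow> (\<exists>c\<in>ext omega. \<exists>d\<in>ext omega. p = pair c d \<and> a \<boxplus> d = c \<boxplus> b))"
  unfolding zdiff_nplus[OF assms(1,2)] using eq_collect_iff[OF assms(3) zdiff_ex[OF assms(1,2)]] by simp

lemma pair_mem_zdiff: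
  assumes "a \<in> ext omega" "b \<in> ext omega" "c \<in> ext omega" "d \<in> ext omega"
  shows "pair c d \<E> zdiff a b \<longleftrightarrow> a \<boxplus> d = c \<boxplus> b"
  using assms by (auto simp: mem_zdiff omega_subset)

lemma zdiff_eq_iff:
  assumes "a \<in> ext omega" "b \<in> ext omega" "a' \<in> ext omega" "b' \<in> ext omega"
  shows "zdiff a b = zdiff a' b' \<longleftrightarrow> a \<boxplus> b' = a' \<boxplus> b"
proof
  assume "zdiff a b = zdiff a' b'"
  moreover have "pair a' b' \<E> zdiff a' b'"
    using assms by (simp add: pair_mem_zdiff)
  ultimately show "a \<boxplus> b' = a' \<boxplus> b"
    using pair_mem_zdiff[OF assms] by simp
next
  assume eq: "a \<boxplus> b' = a' \<boxplus> b"
  have "a \<boxplus> d = c \<boxplus> b \<longleftrightarrow> a' \<boxplus> d = c \<boxplus> b'" if cd: "c \<in> ext omega" "d \<in> ext omega" for c d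
  proof -
    have "a \<boxplus> d = c \<boxplus> b \<longleftrightarrow> (a \<boxplus> d) \<boxplus> b' = (c \<boxplus> b) \<boxplus> b'"
      using assms cd by (simp add: nplus_cancel)
    also have "(a \<boxplus> d) \<boxplus> b' = (a \<boxplus> b') \<boxplus> d"
      using assms cd by (simp add: nplus_ac)
    also have "\<dots> = (a' \<boxplus> d) \<boxplus> b"
      unfolding eq using assms cd by (simp add: nplus_ac)
    also have "(c \<boxplus> b) \<boxplus> b' = (c \<boxplus> b') \<boxplus> b"
      using assms cd by (simp add: nplus_ac)
    also have "(a' \<boxplus> d) \<boxplus> b = (c \<boxplus> b') \<boxplus> b \<longleftrightarrow> a' \<boxplus> d = c \<boxplus> b'"
      using assms cd by (simp add: nplus_cancel)
    finally show ?thesis .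
  qed
  then show "zdiff a b = zdiff a' b'"
    using assms by (intro eqI) (simp_all add: mem_zdiff cong: bex_cong)
qed

lemma carrier_Z_in: "carrier Z_in = {zdiff a b | a b. a \<in> ext omega \<and> b \<in> ext omega}"
  by (simp add: Z_in_def)

lemma one_Z_in: "\<one>\<^bsub>Z_in\<^esub> = zdiff empty empty"
  by (simp add: Z_in_def)

lemma Z_in_cases:
  assumes "z \<in> carrier Z_in"
  obtains a b where "a \<in> ext omega" "b \<in> ext omega" "z = zdiff a b"
  using assms by (auto simp: carrier_Z_in)

lemma Z_in_subset: "z \<in> carrier Z_in \<Longrightarrow> z \<in> U"
  by (auto elim: Z_in_cases)

lemma zdiff_in_Z [simp]: "a \<in> ext omega \<Longrightarrow> b \<in> ext omega \<Longrightarrow> zdiff a b \<in> carrier Z_in"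
  by (auto simp: carrier_Z_in)

lemma mult_Z_in:
  assumes "a \<in> ext omega" "b \<in> ext omega" "c \<in> ext omega" "d \<in> ext omega"
  shows "zdiff a b \<otimes>\<^bsub>Z_in\<^esub> zdiff c d = zdiff (a \<boxplus> c) (b \<boxplus> d)"
proof -
  have "zdiff a b \<otimes>\<^bsub>Z_in\<^esub> zdiff c d = (THE z. \<exists>a'\<in>ext omega. \<exists>b'\<in>ext omega. \<exists>c'\<in>ext omega. \<exists>d'\<in>ext omega.
      zdiff a b = zdiff a' b' \<and> zdiff c d = zdiff c' d' \<and> z = zdiff (a' \<boxplus> c') (b' \<boxplus> d'))"
    by (simp add: Z_in_def nadd_eq_nplus cong: bex_cong)
  also have "\<dots> = zdiff (a \<boxplus> c) (b \<boxplus> d)"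
  \<comment> \<open>The description is proper because the sum does not depend on the
    representatives.\<close>
  proof (rule the_equality)
    fix z assume "\<exists>a'\<in>ext omega. \<exists>b'\<in>ext omega. \<exists>c'\<in>ext omega. \<exists>d'\<in>ext omega.
      zdiff a b = zdiff a' b' \<and> zdiff c d = zdiff c' d' \<and> z = zdiff (a' \<boxplus> c') (b' \<boxplus> d')"
    then obtain a' b' c' d' where *: "a' \<in> ext omega" "b' \<in> ext omega" "c' \<in> ext omega" "d' \<in> ext omega"
      "zdiff a b = zdiff a' b'" "zdiff c d = zdiff c' d'" and z: "z = zdiff (a' \<boxplus> c') (b' \<boxplus> d')"
      by blast
    then have eq: "a \<boxplus> b' = a' \<boxplus> b" "c \<boxplus> d' = c' \<boxplus> d"
      using assms by (simp_all add: zdiff_eq_iff)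
    have "(a' \<boxplus> c') \<boxplus> (b \<boxplus> d) = (a' \<boxplus> b) \<boxplus> (c' \<boxplus> d)"
      using assms *(1-4) by (simp add: nplus_ac)
    also have "\<dots> = (a \<boxplus> c) \<boxplus> (b' \<boxplus> d')"
      unfolding eq[symmetric] using assms *(1-4) by (simp add: nplus_ac)
    finally show "z = zdiff (a \<boxplus> c) (b \<boxplus> d)"
      unfolding z using assms *(1-4) by (simp add: zdiff_eq_iff)
  qed (use assms in blast)
  finally show ?thesis .
qed

lemma comm_group_Z_in: "comm_group Z_in"
proof (rule comm_groupI)
  show "\<one>\<^bsub>Z_in\<^esub> \<in> carrier Z_in"
    by (simp add: one_Z_in)
  fix x assume x: "x \<in> carrier Z_in"
  then obtain a b where ab: "a \<in> ext omega" "b \<in> ext omega" "x = zdiff a b"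
    by (rule Z_in_cases)
  show "\<one>\<^bsub>Z_in\<^esub> \<otimes>\<^bsub>Z_in\<^esub> x = x"
    using ab by (simp add: one_Z_in mult_Z_in)
  have "zdiff b a \<otimes>\<^bsub>Z_in\<^esub> x = \<one>\<^bsub>Z_in\<^esub>"
    using ab by (simp add: one_Z_in mult_Z_in zdiff_eq_iff nplus_comm)
  then show "\<exists>y\<in>carrier Z_in. y \<otimes>\<^bsub>Z_in\<^esub> x = \<one>\<^bsub>Z_in\<^esub>"
    using ab by (intro bexI[of _ "zdiff b a"]) auto
  fix y assume "y \<in> carrier Z_in"
  then obtain c d where cd: "c \<in> ext omega" "d \<in> ext omega" "y = zdiff c d"
    by (rule Z_in_cases)
  show "x \<otimes>\<^bsub>Z_in\<^esub> y \<in> carrier Z_in"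
    using ab cd by (simp add: mult_Z_in)
  show "x \<otimes>\<^bsub>Z_in\<^esub> y = y \<otimes>\<^bsub>Z_in\<^esub> x"
    using ab cd by (simp add: mult_Z_in nplus_comm)
  fix z assume "z \<in> carrier Z_in"
  then obtain e f where "e \<in> ext omega" "f \<in> ext omega" "z = zdiff e f"
    by (rule Z_in_cases)
  with ab cd show "(x \<otimes>\<^bsub>Z_in\<^esub> y) \<otimes>\<^bsub>Z_in\<^esub> z = x \<otimes>\<^bsub>Z_in\<^esub> (y \<otimes>\<^bsub>Z_in\<^esub> z)"
    by (simp add: mult_Z_in nplus_assoc)
qed

sublocale Z: comm_group Z_in
  by (rule comm_group_Z_in)

lemma inv_Z_in: "a \<in> ext omega \<Longrightarrow> b \<in> ext omega \<Longrightarrow> inv\<^bsub>Z_in\<^esub> zdiff a b = zdiff b a"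
  by (rule Z.inv_equality) (simp_all add: one_Z_in mult_Z_in zdiff_eq_iff nplus_comm)

lemma pow_Z_in:
  assumes "a \<in> ext omega" "b \<in> ext omega"
  shows "zdiff a b [^]\<^bsub>Z_in\<^esub> (n :: nat) = zdiff (nmul n a) (nmul n b)"
  using assms by (induction n) (simp_all add: one_Z_in mult_Z_in)

section \<open>Standard integers and divisibility by a standard number\<close>

definition zint :: "int \<Rightarrow> 'a" where
  "zint k = zdiff (num (nat k)) (num (nat (- k)))"

lemma zint_in_Z [simp]: "zint k \<in> carrier Z_in"
  by (simp add: zint_def)

lemma zdiff_num_eq_iff: "zdiff (num a) (num b) = zdiff (num c) (num d) \<longleftrightarrow> a + d = c + b"
  by (simp add: zdiff_eq_iff flip: num_add)

text \<open>\<open>zint\<close> uses the representative in which one entry is 0; here any pair of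
  standard numerals is allowed.\<close>

lemma zint_diff: "zint (int a - int b) = zdiff (num a) (num b)"
  unfolding zint_def zdiff_num_eq_iff by linarith

lemma zint_inject [simp]: "zint k = zint l \<longleftrightarrow> k = l"
  unfolding zint_def zdiff_num_eq_iff by linarith

lemma zint_add: "zint (k + l) = zint k \<otimes>\<^bsub>Z_in\<^esub> zint l"
proof -
  have "zint k \<otimes>\<^bsub>Z_in\<^esub> zint l = zdiff (num (nat k + nat l)) (num (nat (- k) + nat (- l)))"
    by (simp add: zint_def mult_Z_in num_add)
  also have "\<dots> = zint (k + l)"
    unfolding zint_def zdiff_num_eq_iff by linarith
  finally show ?thesis ..
qed

lemma zint_mult: "zint (int d * k) = zint k [^]\<^bsub>Z_in\<^esub> d"
proof (induction d)
  case 0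
  show ?case by (simp add: zint_def one_Z_in)
next
  case (Suc d)
  then show ?case
    using zint_add[of "int d * k" k] by (simp add: algebra_simps)
qed

text \<open>Both entries of a representing pair are divided by \<open>d\<close>. The difference of
  the two remainders may be negative, so it is reduced modulo \<open>d\<close> once more, now among
  the standard integers.\<close>

lemma zint_plus_multiple:
  assumes "z \<in> carrier Z_in" "0 < d"
  shows "\<exists>r\<in>{0..<int d}. \<exists>y\<in>carrier Z_in. z = zint r \<otimes>\<^bsub>Z_in\<^esub> y [^]\<^bsub>Z_in\<^esub> d"
proof -
  obtain a b where z: "a \<in> ext omega" "b \<in> ext omega" "z = zdiff a b"
    using assms(1) by (rule Z_in_cases)
  obtain q m where q: "q \<in> ext omega" "a = num m \<boxplus> nmul d q"
    using omega_division[OF z(1) assms(2)] by (auto simp: ext_num)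
  obtain q' n where q': "q' \<in> ext omega" "b = num n \<boxplus> nmul d q'"
    using omega_division[OF z(2) assms(2)] by (auto simp: ext_num)
  define r where "r = int m - int n"
  have "z = zint r \<otimes>\<^bsub>Z_in\<^esub> zdiff q q' [^]\<^bsub>Z_in\<^esub> d"
    unfolding r_def zint_diff using z q q' by (simp add: pow_Z_in mult_Z_in)
  also have "zint r = zint (r mod int d) \<otimes>\<^bsub>Z_in\<^esub> zint (r div int d) [^]\<^bsub>Z_in\<^esub> d"
    by (simp flip: zint_mult zint_add)
  finally have "z = zint (r mod int d) \<otimes>\<^bsub>Z_in\<^esub> (zint (r div int d) \<otimes>\<^bsub>Z_in\<^esub> zdiff q q') [^]\<^bsub>Z_in\<^esub> d"
    using q q' by (simp add: Z.m_assoc Z.nat_pow_distrib)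
  then show ?thesis
    using assms(2) q q' by (intro bexI[of _ "r mod int d"] bexI[of _ "zint (r div int d) \<otimes>\<^bsub>Z_in\<^esub> zdiff q q'"]) auto
qed

lemma zint_eq_multiple_aux:
  assumes "c \<in> ext omega" "zint k = zdiff (nmul d c) empty" "0 < d"
  shows "int d dvd k"
proof -
  have "num (nat k) = nmul d c \<boxplus> num (nat (- k))"
    using assms(1,2) by (simp add: zint_def zdiff_eq_iff)
  \<comment> \<open>For negative \<open>k\<close>, the positive numeral of \<open>- k\<close> would
    be a summand of \<open>empty\<close>.\<close>
  moreover have "0 \<le> k"
  proof (rule ccontr)
    assume "\<not> 0 \<le> k"
    then have "num (nat (- k)) \<boxplus> nmul d c = empty"
      using calculation assms(1) by (simp add: nplus_comm)
    then have "num (nat (- k)) = num 0"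
      using nplus_eq_empty[of "num (nat (- k))" "nmul d c"] assms(1) by simp
    then show False
      using \<open>\<not> 0 \<le> k\<close> by (simp del: num.simps)
  qed
  ultimately have "nmul d c = num (nat k)"
    using assms(1) by simp
  then have "d dvd nat k"
    by (rule nmul_eq_num[OF assms(1) _ assms(3)])
  then show ?thesis
    using \<open>0 \<le> k\<close> by (simp add: int_dvd_int_iff[symmetric])
qed

text \<open>Both entries of \<open>y\<close> may be nonstandard. By \<open>omega_linear\<close> one
  exceeds the other by some \<open>c\<close>, so up to sign \<open>k\<close> is \<open>d\<close>
  times a natural number of the universe, to which \<open>nmul_eq_num\<close> applies.\<close>

lemma zint_eq_multiple:
  fixes d :: nat
  assumes "y \<in> carrier Z_in" "zint k = y [^]\<^bsub>Z_in\<^esub> d" "0 < d"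
  shows "int d dvd k"
proof -
  obtain a b where y: "a \<in> ext omega" "b \<in> ext omega" "y = zdiff a b"
    using assms(1) by (rule Z_in_cases)
  have k: "zint k = zdiff (nmul d a) (nmul d b)" "zint (- k) = zdiff (nmul d b) (nmul d a)"
  proof -
    show k: "zint k = zdiff (nmul d a) (nmul d b)"
      using assms(2) y by (simp add: pow_Z_in)
    have "zint (- k) = inv\<^bsub>Z_in\<^esub> zint k"
      by (simp add: zint_def inv_Z_in)
    then show "zint (- k) = zdiff (nmul d b) (nmul d a)"
      using y by (simp add: k inv_Z_in)
  qed
  obtain c where c: "c \<in> ext omega" "a = b \<boxplus> c \<or> b = a \<boxplus> c"
    using omega_linear[OF y(1,2)] by blast
  have *: "zdiff (nmul d (x \<boxplus> c)) (nmul d x) = zdiff (nmul d c) empty" if "x \<in> ext omega" for x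
    using that c(1) by (simp add: zdiff_eq_iff nmul_nplus nplus_comm)
  show ?thesis
    using c(2)
  proof
    assume "a = b \<boxplus> c"
    then show ?thesis
      using k(1) *[OF y(2)] zint_eq_multiple_aux[OF c(1) _ assms(3)] by simp
  next
    assume "b = a \<boxplus> c"
    then have "int d dvd - k"
      using k(2) *[OF y(1)] zint_eq_multiple_aux[OF c(1) _ assms(3), of "- k"] by simp
    then show ?thesis by simp
  qed
qed

text \<open>An integer of the universe is a set of pairs and so a subset of \<open>Q\<close>; the
  power set of \<open>Q\<close> thus bounds the integers. Within this bound membership is a formula
  whose parameters come from \<open>r\<close>, and the standard \<open>d\<close> enters through the
  finite term \<open>nmul d\<close>.\<close>

lemma progression_in_U:
  fixes d :: nat
  shows "\<exists>X\<in>U. \<forall>w\<in>U. w \<E> X \<longleftrightarrow> (\<exists>y\<in>carrier Z_in. w = zint r \<otimes>\<^bsub>Z_in\<^esub> y [^]\<^bsub>Z_in\<^esub> d)"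
proof -
  obtain Q where Q: "Q \<in> U" "\<And>i j. i \<in> ext omega \<Longrightarrow> j \<in> ext omega \<Longrightarrow> pair i j \<E> Q"
    using pairs_of_omega_bounded by blast
  obtain B where B: "B \<in> U" "\<And>x. x \<in> U \<Longrightarrow> x \<E> B \<longleftrightarrow> (\<forall>z\<in>U. z \<E> x \<longrightarrow> z \<E> Q)"
    using power_set'[OF Q(1)] by blast
  have zB: "zdiff a b \<E> B" if "a \<in> ext omega" "b \<in> ext omega" for a b
    using that Q(2) by (auto simp: B mem_zdiff)
  define m n where "m = num (nat r)" and "n = num (nat (- r))"
  have mn: "m \<in> ext omega" "n \<in> ext omega"
    by (simp_all add: m_def n_def)
  have r: "zint r = zdiff m n"
    by (simp add: zint_def m_def n_def)
  have "\<exists>X\<in>U. \<forall>w\<in>U. w \<E> X \<longleftrightarrow> w \<E> B \<and> (\<exists>a\<in>ext omega. \<exists>b\<in>ext omega. \<forall>p\<in>U. p \<E> w \<longleftrightarrow>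
      (\<exists>u\<in>ext omega. \<exists>v\<in>ext omega. p = pair u v \<and> (m \<boxplus> nmul d a) \<boxplus> v = u \<boxplus> (n \<boxplus> nmul d b)))"
    using mn by (intro separation_definable[OF B(1)] definable_omega_intros definable_term_nmul)
  moreover have "w \<E> B \<and> (\<exists>a\<in>ext omega. \<exists>b\<in>ext omega. \<forall>p\<in>U. p \<E> w \<longleftrightarrow>
      (\<exists>u\<in>ext omega. \<exists>v\<in>ext omega. p = pair u v \<and> (m \<boxplus> nmul d a) \<boxplus> v = u \<boxplus> (n \<boxplus> nmul d b))) \<longleftrightarrow>
      (\<exists>y\<in>carrier Z_in. w = zint r \<otimes>\<^bsub>Z_in\<^esub> y [^]\<^bsub>Z_in\<^esub> d)" (is "?l \<longleftrightarrow> ?r") if w: "w \<in> U" for w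
  proof -
    have "?l \<longleftrightarrow> w \<E> B \<and> (\<exists>a\<in>ext omega. \<exists>b\<in>ext omega. w = zdiff (m \<boxplus> nmul d a) (n \<boxplus> nmul d b))"
      using w mn by (simp add: eq_zdiff_iff cong: bex_cong)
    also have "\<dots> \<longleftrightarrow> (\<exists>a\<in>ext omega. \<exists>b\<in>ext omega. w = zdiff (m \<boxplus> nmul d a) (n \<boxplus> nmul d b))"
      using mn zB by auto
    also have "\<dots> \<longleftrightarrow> (\<exists>a\<in>ext omega. \<exists>b\<in>ext omega. w = zint r \<otimes>\<^bsub>Z_in\<^esub> zdiff a b [^]\<^bsub>Z_in\<^esub> d)"
      using mn by (simp add: r pow_Z_in mult_Z_in cong: bex_cong)
    also have "\<dots> \<longleftrightarrow> ?r"
      by (auto simp: carrier_Z_in)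
    finally show ?thesis .
  qed
  ultimately show ?thesis
    by (simp cong: ball_cong)
qed

lemma progression_times_singleton_in_U:
  fixes d :: nat
  assumes "c \<in> U"
  shows "\<exists>X\<in>U. \<forall>w\<in>U. w \<E> X \<longleftrightarrow> (\<exists>y\<in>carrier Z_in. w = pair (zint r \<otimes>\<^bsub>Z_in\<^esub> y [^]\<^bsub>Z_in\<^esub> d) c)"
proof -
  obtain X where X: "X \<in> U" "\<And>w. w \<in> U \<Longrightarrow> w \<E> X \<longleftrightarrow> (\<exists>y\<in>carrier Z_in. w = zint r \<otimes>\<^bsub>Z_in\<^esub> y [^]\<^bsub>Z_in\<^esub> d)"
    using progression_in_U[of r d] by auto
  have "\<exists>Y\<in>U. \<forall>w\<in>U. w \<E> Y \<longleftrightarrow> (\<exists>x\<in>U. x \<E> X \<and> w = pair x c)"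
    using assms by (intro replacement_definable X definable_intros) auto
  moreover have "(\<exists>x\<in>U. x \<E> X \<and> w = pair x c) \<longleftrightarrow>
      (\<exists>y\<in>carrier Z_in. w = pair (zint r \<otimes>\<^bsub>Z_in\<^esub> y [^]\<^bsub>Z_in\<^esub> d) c)" for w
  proof -
    have "x \<in> U \<and> x \<E> X \<longleftrightarrow> (\<exists>y\<in>carrier Z_in. x = zint r \<otimes>\<^bsub>Z_in\<^esub> y [^]\<^bsub>Z_in\<^esub> d)" for x
    proof (cases "x \<in> U")
      case False
      then have "x \<notin> carrier Z_in"
        using Z_in_subset by blast
      then show ?thesis
        using False by auto
    qed (simp add: X(2))
    moreover have "(\<exists>x\<in>U. x \<E> X \<and> w = pair x c) \<longleftrightarrow> (\<exists>x. (x \<in> U \<and> x \<E> X) \<and> w = pair x c)"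
      by blast
    ultimately show ?thesis
      by auto
  qed
  ultimately show ?thesis
    by simp
qed

section \<open>Residues, tuples and finite unions\<close>

lemma carrier_Zmod_in: "carrier (Zmod_in N) = num ` {..<N}"
  by (simp add: Zmod_in_def ext_num)

lemma one_Zmod_in: "\<one>\<^bsub>Zmod_in N\<^esub> = num 0"
  by (simp add: Zmod_in_def)

lemma mult_Zmod_in:
  assumes "a < N" "b < N"
  shows "num a \<otimes>\<^bsub>Zmod_in N\<^esub> num b = num ((a + b) mod N)"
proof -
  have "num a \<otimes>\<^bsub>Zmod_in N\<^esub> num b =
      (THE c. c \<in> num ` {..<N} \<and> (num (a + b) = c \<or> num (a + b) = nadd c (num N)))"
    by (simp add: Zmod_in_def ext_num nadd_eq_nplus num_add)
  also have "\<dots> = num ((a + b) mod N)"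
  proof (rule the_equality)
    have "a + b = (a + b) mod N \<or> a + b = (a + b) mod N + N"
      using assms by (auto simp: mod_if)
    then show "num ((a + b) mod N) \<in> num ` {..<N} \<and>
        (num (a + b) = num ((a + b) mod N) \<or> num (a + b) = nadd (num ((a + b) mod N)) (num N))"
      using assms by (auto simp: nadd_eq_nplus simp flip: num_add)
    fix c assume "c \<in> num ` {..<N} \<and> (num (a + b) = c \<or> num (a + b) = nadd c (num N))"
    then obtain k where "k < N" "c = num k" "a + b = k \<or> a + b = k + N"
      by (auto simp: nadd_eq_nplus simp flip: num_add)
    then show "c = num ((a + b) mod N)"
      by auto
  qed
  finally show ?thesis .
qed

lemma comm_group_Zmod_in:
  assumes "0 < N"
  shows "comm_group (Zmod_in N)"
proof (rule comm_groupI)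
  show "\<one>\<^bsub>Zmod_in N\<^esub> \<in> carrier (Zmod_in N)"
    using assms by (simp add: carrier_Zmod_in one_Zmod_in del: num.simps)
  fix x assume "x \<in> carrier (Zmod_in N)"
  then obtain a where a: "a < N" "x = num a"
    by (auto simp: carrier_Zmod_in)
  show "\<one>\<^bsub>Zmod_in N\<^esub> \<otimes>\<^bsub>Zmod_in N\<^esub> x = x"
    using a assms by (simp add: one_Zmod_in mult_Zmod_in del: num.simps)
  have "num ((N - a) mod N) \<otimes>\<^bsub>Zmod_in N\<^esub> x = \<one>\<^bsub>Zmod_in N\<^esub>"
    using a assms by (simp add: one_Zmod_in mult_Zmod_in mod_add_left_eq del: num.simps)
  then show "\<exists>y\<in>carrier (Zmod_in N). y \<otimes>\<^bsub>Zmod_in N\<^esub> x = \<one>\<^bsub>Zmod_in N\<^esub>"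
    using assms by (intro bexI[of _ "num ((N - a) mod N)"]) (auto simp: carrier_Zmod_in)
  fix y assume "y \<in> carrier (Zmod_in N)"
  then obtain b where b: "b < N" "y = num b"
    by (auto simp: carrier_Zmod_in)
  show "x \<otimes>\<^bsub>Zmod_in N\<^esub> y \<in> carrier (Zmod_in N)"
    using a b assms by (auto simp: mult_Zmod_in carrier_Zmod_in)
  show "x \<otimes>\<^bsub>Zmod_in N\<^esub> y = y \<otimes>\<^bsub>Zmod_in N\<^esub> x"
    using a b by (simp add: mult_Zmod_in add.commute)
  fix z assume "z \<in> carrier (Zmod_in N)"
  then obtain c where "c < N" "z = num c"
    by (auto simp: carrier_Zmod_in)
  then show "(x \<otimes>\<^bsub>Zmod_in N\<^esub> y) \<otimes>\<^bsub>Zmod_in N\<^esub> z = x \<otimes>\<^bsub>Zmod_in N\<^esub> (y \<otimes>\<^bsub>Zmod_in N\<^esub> z)"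
    using a b assms by (simp add: mult_Zmod_in mod_add_left_eq mod_add_right_eq add.assoc)
qed

lemma tuple_in_U: "set xs \<subseteq> U \<Longrightarrow> tuple xs \<in> U"
  by (induction xs) auto

lemma tuple_inject:
  "length xs = length ys \<Longrightarrow> set xs \<subseteq> U \<Longrightarrow> set ys \<subseteq> U \<Longrightarrow> tuple xs = tuple ys \<longleftrightarrow> xs = ys"
  by (induction xs ys rule: list_induct2) (auto simp: tuple_in_U)

text \<open>\<open>I\<close> is finite outside the universe, so repeated binary union
  suffices.\<close>

lemma finite_union_in_U:
  assumes "finite I" "\<And>i. i \<in> I \<Longrightarrow> \<exists>x\<in>U. \<forall>w\<in>U. w \<E> x \<longleftrightarrow> P i w"
  shows "\<exists>x\<in>U. \<forall>w\<in>U. w \<E> x \<longleftrightarrow> (\<exists>i\<in>I. P i w)"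
  using assms
proof (induction I rule: finite_induct)
  case empty
  show ?case
    by (intro bexI[of _ empty]) auto
next
  case (insert i I)
  obtain x where x: "x \<in> U" "\<forall>w\<in>U. w \<E> x \<longleftrightarrow> (\<exists>i\<in>I. P i w)"
    using insert.IH insert.prems by auto
  obtain y where y: "y \<in> U" "\<forall>w\<in>U. w \<E> y \<longleftrightarrow> P i w"
    using insert.prems by auto
  show ?case
    using union2[OF y(1) x(1)] x(2) y(2) by (simp cong: ball_cong)
qed

end

section \<open>Comparison of the standard group with the group of a universe\<close>

locale zfc_universe_moduli = zfc_universe +
  fixes Ns :: "nat list"
  assumes Ns: "\<forall>N\<in>set Ns. 0 < N"
begin

abbreviation residues :: "(nat \<Rightarrow> int) monoid" where
  "residues \<equiv> product_group {..<length Ns} (\<lambda>i. integer_mod_group (Ns ! i))"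

abbreviation residues_in :: "(nat \<Rightarrow> 'a) monoid" where
  "residues_in \<equiv> product_group {..<length Ns} (\<lambda>i. Zmod_in (Ns ! i))"

definition std_residues :: "(nat \<Rightarrow> int) \<Rightarrow> nat \<Rightarrow> 'a" where
  "std_residues t = (\<lambda>i\<in>{..<length Ns}. num (nat (t i)))"

lemma std_eq: "std Ns (x, t) = (zint x, std_residues t)"
  by (simp add: std_def zint_def std_residues_def)

lemma modulus_pos: "i < length Ns \<Longrightarrow> 0 < Ns ! i"
  using Ns by simp

sublocale P: comm_group residues
  by (rule comm_group_product_group) simp

sublocale Q: comm_group residues_in
  by (rule comm_group_product_group) (simp add: comm_group_Zmod_in modulus_pos)

sublocale ZP: finite_times_int residues
  by unfold_locales
    (auto simp: carrier_integer_mod_group modulus_pos intro!: finite_PiE)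

lemma ZP_eq: "ZP.ZP = Z_times Ns"
  by (simp add: ZP.ZP_def Z_times_def)

lemma residues_bounds:
  assumes "t \<in> carrier residues" "i < length Ns"
  shows "0 \<le> t i" "t i < int (Ns ! i)"
proof -
  have "t i \<in> carrier (integer_mod_group (Ns ! i))"
    using assms by (auto simp: PiE_iff)
  then show "0 \<le> t i" "t i < int (Ns ! i)"
    using modulus_pos[OF assms(2)] by (auto simp: carrier_integer_mod_group)
qed

lemma std_residues_hom: "std_residues \<in> hom residues residues_in"
proof (rule homI)
  fix s t assume "s \<in> carrier residues" "t \<in> carrier residues"
  then have st: "0 \<le> s i" "s i < int (Ns ! i)" "0 \<le> t i" "t i < int (Ns ! i)" if "i < length Ns" for i
    using that by (auto dest: residues_bounds simp del: carrier_product_group)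
  show "std_residues s \<in> carrier residues_in"
    using st by (auto simp: std_residues_def carrier_Zmod_in nat_less_iff intro!: imageI)
  have "num (nat ((s i + t i) mod int (Ns ! i))) = num (nat (s i)) \<otimes>\<^bsub>Zmod_in (Ns ! i)\<^esub> num (nat (t i))"
    if "i < length Ns" for i
    using st[OF that] by (subst mult_Zmod_in) (auto simp: nat_mod_distrib nat_add_distrib)
  then show "std_residues (s \<otimes>\<^bsub>residues\<^esub> t) = std_residues s \<otimes>\<^bsub>residues_in\<^esub> std_residues t"
    by (auto simp: std_residues_def)
qed

text \<open>By \<open>ext_num\<close> the universe adds no residues to a standard modulus.\<close>

lemma std_residues_bij: "bij_betw std_residues (carrier residues) (carrier residues_in)"
  unfolding bij_betw_def
proof
  show "inj_on std_residues (carrier residues)"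
  proof (rule inj_onI)
    fix s t assume s: "s \<in> carrier residues" and t: "t \<in> carrier residues"
      and eq: "std_residues s = std_residues t"
    show "s = t"
    proof (rule PiE_ext)
      fix i assume i: "i \<in> {..<length Ns}"
      then have "0 \<le> s i" "0 \<le> t i"
        using residues_bounds[OF s] residues_bounds[OF t] by simp_all
      moreover have "num (nat (s i)) = num (nat (t i))"
        using fun_cong[OF eq, of i] i by (simp add: std_residues_def)
      ultimately show "s i = t i"
        by simp
    qed (use s t in simp_all)
  qed
  show "std_residues ` carrier residues = carrier residues_in"
  proof
    show "std_residues ` carrier residues \<subseteq> carrier residues_in"
      using std_residues_hom by (auto simp: hom_def)
    show "carrier residues_in \<subseteq> std_residues ` carrier residues"
    proof
      fix q assume q: "q \<in> carrier residues_in"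
      then have "\<forall>i\<in>{..<length Ns}. \<exists>k. k < Ns ! i \<and> q i = num k"
        by (fastforce simp: PiE_iff carrier_Zmod_in)
      then obtain k where k: "\<And>i. i < length Ns \<Longrightarrow> k i < Ns ! i \<and> q i = num (k i)"
        by (metis lessThan_iff)
      define t where "t = (\<lambda>i\<in>{..<length Ns}. int (k i))"
      have "t \<in> carrier residues"
        using k by (auto simp: t_def carrier_integer_mod_group)
      moreover have "std_residues t = q"
        using q k by (auto simp: std_residues_def t_def PiE_iff extensional_def fun_eq_iff)
      ultimately show "q \<in> std_residues ` carrier residues"
        by blast
    qed
  qed
qed

lemma std_residues_surj:
  assumes "q \<in> carrier residues_in"
  obtains t where "t \<in> carrier residues" "q = std_residues t"
  using assms bij_betw_imp_surj_on[OF std_residues_bij] by blast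

lemma std_residues_closed: "t \<in> carrier residues \<Longrightarrow> std_residues t \<in> carrier residues_in"
  using std_residues_hom unfolding hom_def by blast

lemma std_residues_pow: "t \<in> carrier residues \<Longrightarrow>
    std_residues (t [^]\<^bsub>residues\<^esub> (n :: nat)) = std_residues t [^]\<^bsub>residues_in\<^esub> n"
  by (rule hom_nat_pow[OF std_residues_hom _ P.is_group Q.is_group])

text \<open>Sharper than density: residues are standard already and need no correction, and the
  integer representative lies in a finite range, so finitely many \<open>(r, t)\<close> suffice for
  the whole group.\<close>

lemma Z_times_in_dense:
  assumes "h \<in> carrier (Z_times_in Ns)" "0 < d"
  shows "\<exists>r\<in>{0..<int d}. \<exists>t\<in>carrier residues. \<exists>y\<in>carrier Z_in.
    h = (zint r \<otimes>\<^bsub>Z_in\<^esub> y [^]\<^bsub>Z_in\<^esub> d, std_residues t)"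
proof -
  obtain z q where h: "h = (z, q)" "z \<in> carrier Z_in" "q \<in> carrier residues_in"
    using assms(1) by (auto simp: Z_times_in_def)
  obtain t where "t \<in> carrier residues" "q = std_residues t"
    using std_residues_surj[OF h(3)] .
  then show ?thesis
    using zint_plus_multiple[OF h(2) assms(2)] h(1) by blast
qed

lemma std_times_pow:
  assumes "t \<in> carrier residues"
  shows "std Ns (r, t) \<otimes>\<^bsub>Z_times_in Ns\<^esub> (y, \<one>\<^bsub>residues_in\<^esub>) [^]\<^bsub>Z_times_in Ns\<^esub> d =
    (zint r \<otimes>\<^bsub>Z_in\<^esub> y [^]\<^bsub>Z_in\<^esub> (d :: nat), std_residues t)"
proof -
  have "std_residues t \<in> carrier residues_in"
    using assms by (rule std_residues_closed)
  then have "std_residues t \<otimes>\<^bsub>residues_in\<^esub> \<one>\<^bsub>residues_in\<^esub> [^]\<^bsub>residues_in\<^esub> d = std_residues t"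
    by (simp only: Q.nat_pow_one Q.r_one)
  then show ?thesis
    unfolding Z_times_in_def std_eq pow_DirProd mult_DirProd by (simp only:)
qed

sublocale pure_embedding "Z_times Ns" "Z_times_in Ns" "std Ns"
proof (intro pure_embedding.intro pure_embedding_axioms.intro)
  show "comm_group (Z_times Ns)"
    using ZP.G.comm_group_axioms by (simp add: ZP_eq)
  show "comm_group (Z_times_in Ns)"
    unfolding Z_times_in_def by (intro comm_group_DirProd Z.comm_group_axioms Q.comm_group_axioms)
  show "std Ns \<in> hom (Z_times Ns) (Z_times_in Ns)"
  proof -
    have "zint \<in> hom integer_group Z_in"
      by (auto simp: hom_def zint_add)
    moreover have "std Ns = (\<lambda>(x, t). (zint x, std_residues t))"
      by (auto simp: std_eq)
    ultimately show ?thesis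
      using std_residues_hom by (simp only: Z_times_def Z_times_in_def hom_paired2 P.is_group Q.is_group
          Z.is_group group_integer_group)
  qed
  show "inj_on (std Ns) (carrier (Z_times Ns))"
    using std_residues_bij
    by (auto simp: inj_on_def Z_times_def std_eq bij_betw_def simp del: carrier_product_group)
  show "\<exists>g\<in>carrier (Z_times Ns). \<exists>y\<in>carrier (Z_times_in Ns).
      h = std Ns g \<otimes>\<^bsub>Z_times_in Ns\<^esub> y [^]\<^bsub>Z_times_in Ns\<^esub> d"
    if h: "h \<in> carrier (Z_times_in Ns)" and d: "0 < d" for h and d :: nat
  proof -
    obtain r t y where ty: "t \<in> carrier residues" "y \<in> carrier Z_in"
      and "h = (zint r \<otimes>\<^bsub>Z_in\<^esub> y [^]\<^bsub>Z_in\<^esub> d, std_residues t)"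
      using Z_times_in_dense[OF h d] by blast
    then have "h = std Ns (r, t) \<otimes>\<^bsub>Z_times_in Ns\<^esub> (y, \<one>\<^bsub>residues_in\<^esub>) [^]\<^bsub>Z_times_in Ns\<^esub> d"
      by (simp only: std_times_pow)
    moreover have "(r, t) \<in> carrier (Z_times Ns)" "(y, \<one>\<^bsub>residues_in\<^esub>) \<in> carrier (Z_times_in Ns)"
      using ty Q.one_closed by (simp_all add: Z_times_def Z_times_in_def del: one_product_group carrier_product_group)
    ultimately show ?thesis
      by blast
  qed
  show "\<exists>x\<in>carrier (Z_times Ns). g = x [^]\<^bsub>Z_times Ns\<^esub> d"
    if g: "g \<in> carrier (Z_times Ns)" and y: "y \<in> carrier (Z_times_in Ns)"
      and eq: "std Ns g = y [^]\<^bsub>Z_times_in Ns\<^esub> d" and d: "0 < d" for g y and d :: nat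
  proof -
    obtain x t where xt: "g = (x, t)" "t \<in> carrier residues"
      using g by (auto simp: Z_times_def simp del: carrier_product_group)
    obtain z q where zq: "y = (z, q)" "z \<in> carrier Z_in" "q \<in> carrier residues_in"
      using y by (auto simp: Z_times_in_def simp del: carrier_product_group)
    obtain s where s: "s \<in> carrier residues" "q = std_residues s"
      using std_residues_surj[OF zq(3)] .
    have "zint x = z [^]\<^bsub>Z_in\<^esub> d" "std_residues t = q [^]\<^bsub>residues_in\<^esub> d"
      using eq unfolding Z_times_in_def xt zq std_eq pow_DirProd by simp_all
    \<comment> \<open>Purity holds in each coordinate: for the integers by
      \<open>zint_eq_multiple\<close>, for the residues because they correspond bijectively.\<close>
    then have "int d dvd x" "std_residues t = std_residues (s [^]\<^bsub>residues\<^esub> d)"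
      using zint_eq_multiple[OF zq(2) _ d] s by (simp_all add: std_residues_pow)
    then obtain k where "x = int d * k" "t = s [^]\<^bsub>residues\<^esub> d"
      using inj_onD[OF bij_betw_imp_inj_on[OF std_residues_bij]] xt(2) s(1) P.nat_pow_closed[OF s(1)]
      by (metis dvdE)
    then have "g = (k, s) [^]\<^bsub>Z_times Ns\<^esub> d"
      using xt(1) by (simp add: Z_times_def pow_DirProd)
    then show ?thesis
      using s(1) by (intro bexI[of _ "(k, s)"]) (simp_all add: Z_times_def)
  qed
qed

section \<open>Periodic sets as elements of a universe, and the comparison of solutions\<close>

lemma encode_eq_iff:
  assumes "z \<in> carrier Z_in" "z' \<in> carrier Z_in" "q \<in> carrier residues_in" "q' \<in> carrier residues_in"
  shows "encode Ns (z, q) = encode Ns (z', q') \<longleftrightarrow> z = z' \<and> q = q'"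
proof -
  have U: "set (map f [0..<length Ns]) \<subseteq> U" if "f \<in> carrier residues_in" for f
  proof -
    have "f i \<in> num ` {..<Ns ! i}" if "i < length Ns" for i
      using \<open>f \<in> carrier residues_in\<close> that by (auto simp: PiE_iff carrier_Zmod_in)
    then show ?thesis
      using omega_subset[OF num_in_omega] by fastforce
  qed
  have "z \<in> U" "z' \<in> U"
    using assms(1,2) by (simp_all add: Z_in_subset)
  then have "encode Ns (z, q) = encode Ns (z', q') \<longleftrightarrow>
      z = z' \<and> map q [0..<length Ns] = map q' [0..<length Ns]"
    using U assms(3,4) by (simp add: encode_def tuple_in_U tuple_inject del: carrier_product_group map_eq_conv)
  also have "map q [0..<length Ns] = map q' [0..<length Ns] \<longleftrightarrow> q = q'"
    using assms(3,4) by (auto simp: PiE_iff intro: extensionalityI)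
  finally show ?thesis .
qed

text \<open>\<open>spread d S\<close> is the union of the progressions with difference
  \<open>d\<close> and fixed residues through the finitely many elements of \<open>S\<close> with
  integer coordinate in \<open>{0..<int d}\<close>. Encoded, each progression is paired with one
  fixed tuple and so is an element of \<open>U\<close>.\<close>

lemma spread_in_U:
  assumes S: "power_closed (Z_times Ns) d S" and d: "0 < d"
  shows "\<exists>x\<in>U. subset_in Ns x = spread d S"
proof -
  let ?I = "S \<inter> ({0..<int d} \<times> carrier residues)"
  let ?R = "\<lambda>a w. \<exists>y\<in>carrier Z_in. w = encode Ns (zint (fst a) \<otimes>\<^bsub>Z_in\<^esub> y [^]\<^bsub>Z_in\<^esub> d, std_residues (snd a))"
  have "finite ?I"
    using ZP.finite_P by blast
  moreover have "\<exists>x\<in>U. \<forall>w\<in>U. w \<E> x \<longleftrightarrow> ?R a w" if "a \<in> ?I" for a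
  proof -
    have "tuple (map (std_residues (snd a)) [0..<length Ns]) \<in> U"
      by (rule tuple_in_U) (auto simp: std_residues_def omega_subset)
    from progression_times_singleton_in_U[OF this, of "fst a" d] show ?thesis
      by (simp add: encode_def)
  qed
  ultimately obtain x where x: "x \<in> U" "\<forall>w\<in>U. w \<E> x \<longleftrightarrow> (\<exists>a\<in>?I. ?R a w)"
    using finite_union_in_U[of ?I ?R] by blast
  have "encode Ns h \<E> x \<longleftrightarrow> h \<in> spread d S" if h: "h \<in> carrier (Z_times_in Ns)" for h
  proof -
    have mem_iff: "(zint r \<otimes>\<^bsub>Z_in\<^esub> y [^]\<^bsub>Z_in\<^esub> d, std_residues t) \<in> spread d S \<longleftrightarrow> (r, t) \<in> S"
      if "t \<in> carrier residues" "y \<in> carrier Z_in" for r t y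
      using mem_spread_iff[OF S d, of "(r, t)" "(y, \<one>\<^bsub>residues_in\<^esub>)"] that Q.one_closed
      unfolding std_times_pow[OF that(1)]
      by (simp add: Z_times_def Z_times_in_def del: one_product_group carrier_product_group)
    obtain r t y where r: "r \<in> {0..<int d}" "t \<in> carrier residues" "y \<in> carrier Z_in"
      and h_eq: "h = (zint r \<otimes>\<^bsub>Z_in\<^esub> y [^]\<^bsub>Z_in\<^esub> d, std_residues t)"
      using Z_times_in_dense[OF h d] by blast
    have "set (map (std_residues t) [0..<length Ns]) \<subseteq> U"
      by (auto simp: std_residues_def omega_subset)
    moreover have "zint r \<otimes>\<^bsub>Z_in\<^esub> y [^]\<^bsub>Z_in\<^esub> d \<in> U"
      using r(3) by (simp add: Z_in_subset)
    ultimately have "encode Ns h \<in> U"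
      by (simp add: encode_def h_eq tuple_in_U)
    then have "encode Ns h \<E> x \<longleftrightarrow> (\<exists>a\<in>?I. ?R a (encode Ns h))"
      using x(2) by blast
    also have "\<dots> \<longleftrightarrow> (\<exists>a\<in>?I. \<exists>u\<in>carrier Z_in. h = (zint (fst a) \<otimes>\<^bsub>Z_in\<^esub> u [^]\<^bsub>Z_in\<^esub> d, std_residues (snd a)))"
    proof (intro bex_cong refl)
      fix a u assume "a \<in> ?I" "u \<in> carrier Z_in"
      then show "encode Ns h = encode Ns (zint (fst a) \<otimes>\<^bsub>Z_in\<^esub> u [^]\<^bsub>Z_in\<^esub> d, std_residues (snd a)) \<longleftrightarrow>
          h = (zint (fst a) \<otimes>\<^bsub>Z_in\<^esub> u [^]\<^bsub>Z_in\<^esub> d, std_residues (snd a))"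
        unfolding h_eq using r std_residues_closed by (subst encode_eq_iff) (auto simp del: carrier_product_group)
    qed
    also have "\<dots> \<longleftrightarrow> h \<in> spread d S"
    proof
      assume "\<exists>a\<in>?I. \<exists>u\<in>carrier Z_in. h = (zint (fst a) \<otimes>\<^bsub>Z_in\<^esub> u [^]\<^bsub>Z_in\<^esub> d, std_residues (snd a))"
      then obtain a u where a: "a \<in> S" "snd a \<in> carrier residues" "u \<in> carrier Z_in"
        "h = (zint (fst a) \<otimes>\<^bsub>Z_in\<^esub> u [^]\<^bsub>Z_in\<^esub> d, std_residues (snd a))"
        by auto
      then show "h \<in> spread d S"
        using mem_iff[OF a(2,3), of "fst a"] by simp
    next
      assume "h \<in> spread d S"
      then have "(r, t) \<in> ?I"
        using mem_iff[OF r(2,3), of r] r h_eq by blast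
      then show "\<exists>a\<in>?I. \<exists>u\<in>carrier Z_in. h = (zint (fst a) \<otimes>\<^bsub>Z_in\<^esub> u [^]\<^bsub>Z_in\<^esub> d, std_residues (snd a))"
        using r(3) h_eq by (intro bexI[of _ "(r, t)"] bexI[of _ y]) auto
    qed
    finally show ?thesis .
  qed
  moreover have "spread d S \<subseteq> carrier (Z_times_in Ns)"
    by (rule spread_subset) (use S in \<open>simp add: power_closed_def\<close>)
  ultimately have "subset_in Ns x = spread d S"
    by (auto simp: subset_in_def)
  then show ?thesis
    using x(1) by blast
qed

lemma solvable_in_iff:
  assumes F: "\<forall>j\<in>{1..J}. finite (F j) \<and> F j \<subseteq> carrier (Z_times Ns)"
    and E: "periodic_set (Z_times Ns) E"
  shows "solvable_in Ns J F E \<longleftrightarrow> (\<exists>A. tiling (Z_times Ns) J F E A)"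
proof -
  \<comment> \<open>Some exponent works, so \<open>LEAST\<close> in \<open>exponent_of\<close>
    denotes one that does. The transfer is carried out with that very exponent because
    \<open>periodic_in\<close> uses it.\<close>
  obtain d' where "0 < d'" "power_closed (Z_times Ns) d' E"
    using G.periodic_set_imp_power_closed[OF E] by blast
  then have EG: "E \<subseteq> carrier (Z_times Ns)" and
    ex: "0 < d' \<and> (\<forall>e\<in>E. \<forall>y\<in>carrier (Z_times Ns). e \<otimes>\<^bsub>Z_times Ns\<^esub> (y [^]\<^bsub>Z_times Ns\<^esub> d') \<in> E)"
    by (auto simp: power_closed_def)
  define d where "d = exponent_of Ns E"
  have d: "power_closed (Z_times Ns) d E" "0 < d"
    using LeastI[of "\<lambda>d. 0 < d \<and> (\<forall>e\<in>E. \<forall>y\<in>carrier (Z_times Ns). e \<otimes>\<^bsub>Z_times Ns\<^esub> (y [^]\<^bsub>Z_times Ns\<^esub> d) \<in> E)", OF ex] EG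
    by (auto simp: d_def exponent_of_def power_closed_def)
  have E_in: "periodic_in Ns E = spread d E"
    by (simp add: periodic_in_def spread_def d_def)
  show ?thesis
  proof
    assume "solvable_in Ns J F E"
    then show "\<exists>A. tiling (Z_times Ns) J F E A"
      unfolding solvable_in_def E_in using tiling_pull_back[OF F d] by blast
  next
    assume "\<exists>A. tiling (Z_times Ns) J F E A"
    then obtain A where "tiling (Z_times Ns) J F E A" ..
    \<comment> \<open>The given solution need not come from an element of the universe, so it is
      first replaced by a periodic one.\<close>
    then obtain D B where D: "0 < D" "d dvd D" and B: "tiling (Z_times Ns) J F E B"
      "\<And>j. power_closed (Z_times Ns) D (B j)"
      using ZP.tiling_imp_power_closed_tiling[of J F d E A] F d unfolding ZP_eq by blast
    have "\<forall>j. \<exists>x\<in>U. subset_in Ns x = spread D (B j)"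
      using spread_in_U[OF B(2) D(1)] by blast
    then obtain X where X: "\<And>j. X j \<in> U" "\<And>j. subset_in Ns (X j) = spread D (B j)"
      by metis
    have "tiling (Z_times_in Ns) J (\<lambda>j. std Ns ` F j) (spread d E) (\<lambda>j. subset_in Ns (X j))"
      unfolding X(2) by (rule tiling_push_forward[OF F d B D])
    then show "solvable_in Ns J F E"
      unfolding solvable_in_def E_in using X by blast
  qed
qed

end

lemma not_aperiodic_tile:
  assumes "\<forall>N\<in>set Ns. 0 < N"
    and F: "\<forall>j\<in>{1..J}. finite (F j) \<and> F j \<subseteq> carrier (Z_times Ns)"
    and E: "periodic_set (Z_times Ns) E"
  shows "\<not> aperiodic_tile (Z_times Ns) J F E"
proof -
  let ?P = "product_group {..<length Ns} (\<lambda>i. integer_mod_group (Ns ! i))"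
  interpret P: comm_group ?P
    by (rule comm_group_product_group) simp
  interpret ZP: finite_times_int ?P
    by unfold_locales (use assms(1) in \<open>auto simp: carrier_integer_mod_group intro!: finite_PiE\<close>)
  have ZP: "ZP.ZP = Z_times Ns"
    by (simp add: ZP.ZP_def Z_times_def)
  obtain d where d: "0 < d" "power_closed ZP.ZP d E"
    using ZP.G.periodic_set_imp_power_closed E unfolding ZP by blast
  show ?thesis
    unfolding aperiodic_tile_def ZP[symmetric]
    using ZP.tiling_imp_power_closed_tiling[OF F[folded ZP] d(2,1)] ZP.power_closed_imp_periodic_set by metis
qed

theorem theorem2p1:
  fixes Ns :: "nat list" and J :: nat
    and F :: "nat \<Rightarrow> (int \<times> (nat \<Rightarrow> int)) set" and E :: "(int \<times> (nat \<Rightarrow> int)) set"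
  assumes "\<forall>N\<in>set Ns. 0 < N"
    and "1 \<le> J"
    and "\<forall>j\<in>{1..J}. finite (F j) \<and> F j \<subseteq> carrier (Z_times Ns)"
    and "periodic_set (Z_times Ns) E"
  shows "\<not> aperiodic_tile (Z_times Ns) J F E \<and> decidable_tile TYPE('u) Ns J F E"
proof
  show "\<not> aperiodic_tile (Z_times Ns) J F E"
    by (rule not_aperiodic_tile) fact+
  \<comment> \<open>The right-hand side does not mention the universe, so no two universes can
    disagree.\<close>
  have "set_structure.solvable_in U mem Ns J F E \<longleftrightarrow> (\<exists>A. tiling (Z_times Ns) J F E A)"
    if "zfc_universe U mem" for U :: "'u set" and mem
  proof -
    interpret zfc_universe_moduli U mem Ns
      using that assms(1) by (simp add: zfc_universe_moduli_def zfc_universe_moduli_axioms_def)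
    show ?thesis
      by (rule solvable_in_iff) fact+
  qed
  then show "decidable_tile TYPE('u) Ns J F E"
    unfolding undecidable_tile_def by blast
qed

end
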